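(* Let $G\simeq[k,l,m]$ be a crystallographic string Coxeter group of rank $4$ (so $k,l,m\in\{2,3,4,6,\infty\}$), and suppose that the subgroup $[k,l]=\langle r_0,r_1,r_2\rangle$ or the subgroup $[l,m]=\langle r_1,r_2,r_3\rangle$ is spherical (i.e. finite). Then for every prime $p\ge 3$ the reduction $G^p$ of $G$ modulo $p$ is a (string) C-group.
   Context: Setting. $G=\langle r_0,\dots,r_{n-1}\rangle=[p_1,\dots,p_{n-1}]$ denotes a crystallographic Coxeter group with string Coxeter diagram (nodes $0,\dots,n-1$; the branch joining nodes $i-1$ and $i$ is marked $p_i$; $p_i=2$ means no branch), so each $p_i\in\{2,3,4,6,\infty\}$, in its standard representation as a reflection group on real $n$-space $V$. A basic system is a basis $b_0,\dots,b_{n-1}$ of $V$ of suitably rescaled simple roots: $b_i\cdot b_i>0$, $b_{i-1}\cdot b_i=-\cos(\pi/p_i)\sqrt{(b_{i-1}\cdot b_{i-1})(b_i\cdot b_i)}$ (with $\cos(\pi/\infty)=1$), $b_i\cdot b_j=0$ for $|i-j|\ge2$, $r_i(x)=x-2\frac{x\cdot b_i}{b_i\cdot b_i}b_i$, and all numbers $2\frac{b_i\cdot b_j}{b_i\cdot b_i}$ are integers. Reduction. For an odd prime $p$, the integer matrices of the $r_i$ in the basis $(b_i)$ are reduced modulo $p$; $G^p$ is the subgroup of $GL_n(\mathbb Z_p)$ (where $\mathbb Z_p=\mathbb Z/p\mathbb Z$) generated by these reductions, again denoted $r_0,\dots,r_{n-1}$. In some cases with $p=3$ and some $p_i=6$,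 $G^p$ may depend on the basic system; the statement refers to any choice of basic system. $G^p$ is a (string) C-group if $\langle r_i\mid i\in I\rangle\cap\langle r_i\mid i\in J\rangle=\langle r_i\mid i\in I\cap J\rangle$ in $G^p$ for all $I,J\subseteq\{0,\dots,n-1\}$. *)

theory Defs
  imports
    Complex_Main
    "HOL-Library.Extended_Nat"
    "HOL-Computational_Algebra.Primes"
    "HOL-Algebra.Bij"
    "HOL-Algebra.Generated_Groups"
    "Jordan_Normal_Form.Matrix"
begin

section \<open>Basic systems of string Coxeter groups\<close>

definition cos_mark :: "enat \<Rightarrow> real" where
  "cos_mark q = (case q of enat k \<Rightarrow> cos (pi / real k) | \<infinity> \<Rightarrow> 1)"

text \<open>
  The list \<open>ps\<close> holds the marks \<open>p\<^sub>1, \<dots>, p\<^sub>n\<^sub>-\<^sub>1\<close>; since list positions start at 0, the branch joining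
  nodes \<open>i\<close> and \<open>i + 1\<close> carries the mark \<open>ps ! i\<close>, and the rank is \<open>n = length ps + 1\<close>.
  The real \<open>n\<close>-space is the whole type \<^typ>\<open>'v\<close>, with scalar product \<open>B\<close>, which need neither be
  definite nor nondegenerate.  As the \<open>b i\<close> form a basis of \<^typ>\<open>'v\<close>, their scalar products determine
  \<open>B\<close>: the vectors \<open>b i\<close> divided by \<open>sqrt (B (b i) (b i))\<close> are the simple roots of the
  standard representation.
\<close>

definition basic_system ::
    "enat list \<Rightarrow> ('v::real_vector \<Rightarrow> 'v \<Rightarrow> real) \<Rightarrow> (nat \<Rightarrow> 'v) \<Rightarrow> bool" where
  "basic_system ps B b \<longleftrightarrow> (let n = length ps + 1 in
     (\<forall>x. linear (B x)) \<and> (\<forall>x y. B x y = B y x) \<and>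
     inj_on b {..<n} \<and> independent (b ` {..<n}) \<and> span (b ` {..<n}) = UNIV \<and>
     (\<forall>i<n. B (b i) (b i) > 0) \<and>
     (\<forall>i. i + 1 < n \<longrightarrow>
        B (b i) (b (i + 1)) = - cos_mark (ps ! i) * sqrt (B (b i) (b i) * B (b (i + 1)) (b (i + 1)))) \<and>
     (\<forall>i<n. \<forall>j<n. i + 2 \<le> j \<longrightarrow> B (b i) (b j) = 0) \<and>
     (\<forall>i<n. \<forall>j<n. 2 * B (b i) (b j) / B (b i) (b i) \<in> \<int>))"

definition reflection :: "('v::real_vector \<Rightarrow> 'v \<Rightarrow> real) \<Rightarrow> (nat \<Rightarrow> 'v) \<Rightarrow> nat \<Rightarrow> 'v \<Rightarrow> 'v" where
  "reflection B b i x = x - (2 * B x (b i) / B (b i) (b i)) *\<^sub>R b i"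

definition refl_subgroup ::
    "('v::real_vector \<Rightarrow> 'v \<Rightarrow> real) \<Rightarrow> (nat \<Rightarrow> 'v) \<Rightarrow> nat set \<Rightarrow> ('v \<Rightarrow> 'v) set" where
  "refl_subgroup B b I = generate (BijGroup UNIV) (reflection B b ` I)"

section \<open>Reduction modulo a prime\<close>

text \<open>
  The matrix of the \<open>i\<close>-th reflection in the basis \<open>b\<close>; column \<open>j\<close> holds the coordinates of
  the image of \<open>b j\<close>.  For a basic system these coordinates are integers, so the floor only changes
  the type of the entries; see \<open>of_int_refl_mat\<close> below.
\<close>

definition refl_mat ::
    "nat \<Rightarrow> ('v::real_vector \<Rightarrow> 'v \<Rightarrow> real) \<Rightarrow> (nat \<Rightarrow> 'v) \<Rightarrow> nat \<Rightarrow> int mat" where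
  "refl_mat n B b i =
     mat n n (\<lambda>(a, j). \<lfloor>representation (b ` {..<n}) (reflection B b i (b j)) (b a)\<rfloor>)"

definition reduce_mat :: "nat \<Rightarrow> int mat \<Rightarrow> int mat" where
  "reduce_mat p A = map_mat (\<lambda>x. x mod int p) A"

text \<open>
  The residue classes modulo \<open>p\<close> are represented by \<open>{0..<p}\<close>, as in \<open>residue_ring\<close>.
\<close>

definition matrix_monoid_mod :: "nat \<Rightarrow> nat \<Rightarrow> int mat monoid" where
  "matrix_monoid_mod n p =
     \<lparr>carrier = {A \<in> carrier_mat n n. elements_mat A \<subseteq> {0..<int p}},
      mult = \<lambda>A A'. reduce_mat p (A * A'),
      one = reduce_mat p (1\<^sub>m n)\<rparr>"

definition GL_mod :: "nat \<Rightarrow> nat \<Rightarrow> int mat monoid" where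
  "GL_mod n p = units_of (matrix_monoid_mod n p)"

definition reduced_refl ::
    "nat \<Rightarrow> nat \<Rightarrow> ('v::real_vector \<Rightarrow> 'v \<Rightarrow> real) \<Rightarrow> (nat \<Rightarrow> 'v) \<Rightarrow> nat \<Rightarrow> int mat" where
  "reduced_refl n p B b i = reduce_mat p (refl_mat n B b i)"

text \<open>
  The intersection property for the subgroup of \<open>H\<close> generated by \<open>r 0, \<dots>, r (n - 1)\<close>.
\<close>

definition C_group :: "('a, 'c) monoid_scheme \<Rightarrow> nat \<Rightarrow> (nat \<Rightarrow> 'a) \<Rightarrow> bool" where
  "C_group H n r \<longleftrightarrow>
     (\<forall>I J. I \<subseteq> {..<n} \<longrightarrow> J \<subseteq> {..<n} \<longrightarrow>
        generate H (r ` I) \<inter> generate H (r ` J) = generate H (r ` (I \<inter> J)))"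

section \<open>Integrality of the reflection matrices\<close>

lemma representation_reflection:
  assumes bs: "basic_system ps B b" and n: "n = length ps + 1"
    and "i < n" "j < n" "a < n"
  shows "representation (b ` {..<n}) (reflection B b i (b j)) (b a) =
    (if a = j then 1 else 0) - (if a = i then 2 * B (b i) (b j) / B (b i) (b i) else 0)"
proof -
  have ind: "independent (b ` {..<n})" and inj: "inj_on b {..<n}"
    and sym: "B (b j) (b i) = B (b i) (b j)"
    using bs unfolding basic_system_def n[symmetric] Let_def by auto
  have basis: "representation (b ` {..<n}) (b k) (b a) = (if a = k then 1 else 0)" if "k < n" for k
    using representation_basis[OF ind, of "b k"] that \<open>a < n\<close> inj by (auto simp: inj_on_def)
  show ?thesis
    unfolding reflection_def using \<open>i < n\<close> \<open>j < n\<close> sym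
    by (subst representation_diff[OF ind])
       (auto simp: representation_scale[OF ind] basis span_base span_scale)
qed

lemma of_int_refl_mat:
  assumes "basic_system ps B b" "n = length ps + 1" "i < n" "j < n" "a < n"
  shows "real_of_int (refl_mat n B b i $$ (a, j)) =
    representation (b ` {..<n}) (reflection B b i (b j)) (b a)"
proof -
  have "2 * B (b i) (b j) / B (b i) (b i) \<in> \<int>"
    using assms unfolding basic_system_def Let_def by auto
  then have "representation (b ` {..<n}) (reflection B b i (b j)) (b a) \<in> \<int>"
    unfolding representation_reflection[OF assms] by (auto intro: Ints_diff)
  then show ?thesis
    using assms by (auto simp: refl_mat_def elim: Ints_cases)
qed

end

theory Submission
  imports Defs "HOL-Number_Theory.Cong"
begin

text \<open>
  Write \<open>c\<^sub>i\<close> for the row of integers \<open>2 b\<^sub>i \<cdot> b\<^sub>j / b\<^sub>i \<cdot> b\<^sub>i\<close>.  Multiplying a row vector by the matrix of \<open>r\<^sub>i\<close>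
  from the right sends \<open>v\<close> to \<open>v - v\<^sub>i c\<^sub>i\<close>, so elements of \<open>G\<^sup>p\<close> are words in these row operations,
  taken modulo \<open>p\<close>.  Every \<open>r\<^sub>i\<close> with \<open>i \<noteq> a\<close> fixes the unit row \<open>e\<^sub>a\<close>, hence an element of
  \<open>\<langle>I\<rangle> \<inter> \<langle>J\<rangle>\<close> fixes all \<open>e\<^sub>a\<close> with \<open>a \<notin> I \<inter> J\<close>.  If \<open>\<langle>K\<rangle>\<close> is the full stabiliser of \<open>e\<^sub>a\<close> in
  \<open>\<langle>{a} \<union> K\<rangle>\<close>, this forces \<open>\<langle>{a} \<union> K\<rangle> \<inter> \<langle>J\<rangle> = \<langle>K\<rangle>\<close> whenever \<open>K \<subseteq> J\<close> and \<open>a \<notin> J\<close>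
  (\<open>meet_property_by_stabilizer\<close>).  Two general facts reduce the number of pairs \<open>I, J\<close>: disjoint sets
  meet trivially, since then every unit row is fixed, and a node commuting with all the others can be
  split off (\<open>meet_property_insert_commuting\<close>).  For a string diagram of rank 4 with nodes \<open>a, b, c, d\<close>
  there remain the pairs \<open>abc, bcd\<close> and \<open>ab, bc\<close> and \<open>bc, cd\<close> (\<open>meet_property_rank_4\<close>).

  Number the nodes so that \<open>\<langle>a, b, c\<rangle>\<close> is the finite one.  A finite group preserves a positive definite
  form, in which the \<open>r\<^sub>i\<close> are again reflections in the \<open>b\<^sub>i\<close>; this gives
  \<open>c\<^sub>a\<^sub>b c\<^sub>b\<^sub>a + c\<^sub>b\<^sub>c c\<^sub>c\<^sub>b < 4\<close> (\<open>cartan_products_if_finite\<close>).  Since the product belonging to a mark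
  \<open>2, 3, 4, 6, \<infinity>\<close> is \<open>0, 1, 2, 3, 4\<close>, one of the two marks is 2, or the marks are 3, 3 or 3, 4 or 4, 3.

  The stabilisers are found by enumerating cosets: the orbit of \<open>e\<^sub>a\<close> is run through by the shortest
  coset representatives, and its other members are visibly different from \<open>e\<^sub>a\<close> modulo every
  \<open>p \<ge> 3\<close>, because their coordinates are so small.  The one exception is a mark 6 with \<open>p = 3\<close> and
  \<open>c\<^sub>a\<^sub>b = - 3\<close>, where a rotation of order 3 fixes \<open>e\<^sub>a\<close>.  If the other mark next to the 6 is 2, splitting off the
  commuting node avoids the stabiliser.  If the 6 is the middle mark, the stabiliser of \<open>e\<^sub>d\<close> in
  \<open>\<langle>c, d\<rangle>\<close> serves instead; a mark \<open>\<infinity>\<close> there does no harm, as \<open>c\<^sub>c\<^sub>d c\<^sub>d\<^sub>c = 4\<close> is 1 modulo 3 and the group is that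
  of a mark 3.  Only when the last mark is a 6 with \<open>c\<^sub>d\<^sub>c = - 3\<close> do both stabilisers fail, and then the
  image of \<open>e\<^sub>c\<close> is pinned down by one linear relation from each side
  (\<open>meet_property_6_6_mod_3\<close>).
\<close>

section \<open>Words of reflections acting on integer rows\<close>

text \<open>
  Right multiplication of a row vector by the matrix of the \<open>i\<close>-th reflection, when \<open>C\<close> is the matrix of
  Cartan integers.
\<close>

definition reflect_row :: "(nat \<Rightarrow> nat \<Rightarrow> int) \<Rightarrow> nat \<Rightarrow> (nat \<Rightarrow> int) \<Rightarrow> nat \<Rightarrow> int" where
  "reflect_row C i v = (\<lambda>j. v j - v i * C i j)"

abbreviation word_row :: "(nat \<Rightarrow> nat \<Rightarrow> int) \<Rightarrow> nat list \<Rightarrow> (nat \<Rightarrow> int) \<Rightarrow> nat \<Rightarrow> int" where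
  "word_row C w \<equiv> fold (reflect_row C) w"

definition unit_row :: "nat \<Rightarrow> nat \<Rightarrow> int" where
  "unit_row i = (\<lambda>j. if j = i then 1 else 0)"

definition rows_cong :: "nat \<Rightarrow> nat \<Rightarrow> (nat \<Rightarrow> int) \<Rightarrow> (nat \<Rightarrow> int) \<Rightarrow> bool" where
  "rows_cong n p v w \<longleftrightarrow> (\<forall>j<n. [v j = w j] (mod int p))"

text \<open>
  Congruence is required on all rows \<open>v\<close>, not only on unit rows, so that \<open>same_action_append\<close> needs
  no linearity; \<open>same_action_if_unit_rows\<close> shows that unit rows suffice.
\<close>

definition same_action :: "nat \<Rightarrow> nat \<Rightarrow> (nat \<Rightarrow> nat \<Rightarrow> int) \<Rightarrow> nat list \<Rightarrow> nat list \<Rightarrow> bool" where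
  "same_action n p C u w \<longleftrightarrow> (\<forall>v. rows_cong n p (word_row C u v) (word_row C w v))"

text \<open>
  The generators are involutions, so words without inverses describe all of a subgroup.
\<close>

definition meet_property :: "nat \<Rightarrow> nat \<Rightarrow> (nat \<Rightarrow> nat \<Rightarrow> int) \<Rightarrow> nat set \<Rightarrow> nat set \<Rightarrow> bool" where
  "meet_property n p C I J \<longleftrightarrow>
     (\<forall>u w. set u \<subseteq> I \<longrightarrow> set w \<subseteq> J \<longrightarrow> same_action n p C u w \<longrightarrow>
        (\<exists>z. set z \<subseteq> I \<inter> J \<and> same_action n p C u z))"

lemma rows_cong_refl [simp]: "rows_cong n p v v"
  by (simp add: rows_cong_def)

lemma rows_cong_sym: "rows_cong n p v w \<Longrightarrow> rows_cong n p w v"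
  by (simp add: rows_cong_def cong_sym)

lemma rows_cong_trans: "rows_cong n p u v \<Longrightarrow> rows_cong n p v w \<Longrightarrow> rows_cong n p u w"
  unfolding rows_cong_def by (meson cong_trans)

lemma rows_cong_reflect_row:
  assumes "rows_cong n p v w" "i < n"
  shows "rows_cong n p (reflect_row C i v) (reflect_row C i w)"
  using assms by (auto simp: rows_cong_def reflect_row_def intro!: cong_diff cong_mult)

lemma rows_cong_word_row:
  assumes "rows_cong n p v w" "set u \<subseteq> {..<n}"
  shows "rows_cong n p (word_row C u v) (word_row C u w)"
  using assms by (induction u arbitrary: v w) (auto intro: rows_cong_reflect_row)

lemma same_action_refl [simp]: "same_action n p C u u"
  by (simp add: same_action_def)

lemma same_action_sym: "same_action n p C u w \<Longrightarrow> same_action n p C w u"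
  by (simp add: same_action_def rows_cong_sym)

lemma same_action_trans [trans]:
  "same_action n p C u v \<Longrightarrow> same_action n p C v w \<Longrightarrow> same_action n p C u w"
  unfolding same_action_def by (meson rows_cong_trans)

lemma same_action_append:
  assumes "same_action n p C u u'" "same_action n p C w w'" "set w' \<subseteq> {..<n}"
  shows "same_action n p C (u @ w) (u' @ w')"
proof -
  have "rows_cong n p (word_row C w' (word_row C u v)) (word_row C w' (word_row C u' v))" for v
    using assms by (intro rows_cong_word_row) (auto simp: same_action_def)
  moreover have "rows_cong n p (word_row C w (word_row C u v)) (word_row C w' (word_row C u v))" for v
    using assms by (auto simp: same_action_def)
  ultimately show ?thesis
    unfolding same_action_def fold_append comp_def by (meson rows_cong_trans)
qed

lemma same_actionI: "(\<And>v. word_row C u v = word_row C w v) \<Longrightarrow> same_action n p C u w"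
  by (simp add: same_action_def)

lemma reflect_row_involution:
  assumes "C i i = 2"
  shows "reflect_row C i (reflect_row C i v) = v"
  using assms by (auto simp: reflect_row_def)

lemma reflect_row_commute:
  assumes "C i j = 0" "C j i = 0"
  shows "reflect_row C i (reflect_row C j v) = reflect_row C j (reflect_row C i v)"
  using assms by (auto simp: reflect_row_def)

lemma word_row_fixes_unit_row:
  assumes "i \<notin> set w"
  shows "word_row C w (unit_row i) = unit_row i"
  using assms
  by (induction w) (auto simp: reflect_row_def unit_row_def)

text \<open>
  This is how an element of \<open>\<langle>I\<rangle> \<inter> \<langle>J\<rangle>\<close> is seen to fix a unit row: one of its two words avoids
  the letter \<open>i\<close>.
\<close>

lemma unit_row_fixed_mod:
  assumes "same_action n p C u w" "i \<notin> set w"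
  shows "rows_cong n p (word_row C u (unit_row i)) (unit_row i)"
  using assms word_row_fixes_unit_row[of i w C] unfolding same_action_def by metis

text \<open>
  Linearity of the action of a word; at the same time the formula for multiplying its matrix by a row.
\<close>

lemma word_row_expand:
  assumes "set w \<subseteq> {..<n}" "j < n"
  shows "word_row C w v j = (\<Sum>x<n. v x * word_row C w (unit_row x) j)"
  using assms
proof (induction w arbitrary: j rule: rev_induct)
  case Nil
  then show ?case by (simp add: unit_row_def if_distrib sum.delta cong: if_cong)
next
  case (snoc i w)
  then show ?case
    by (simp add: reflect_row_def right_diff_distrib sum_subtractf sum_distrib_right mult.assoc)
qed

lemma same_action_if_unit_rows:
  assumes "set u \<subseteq> {..<n}" "set w \<subseteq> {..<n}"
    and "\<And>x. x < n \<Longrightarrow> rows_cong n p (word_row C u (unit_row x)) (word_row C w (unit_row x))"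
  shows "same_action n p C u w"
  using assms unfolding same_action_def rows_cong_def
  by (auto simp: word_row_expand[of u n] word_row_expand[of w n] intro!: cong_sum cong_mult)

section \<open>The intersection property in terms of words\<close>

lemma meet_property_sym: "meet_property n p C I J \<Longrightarrow> meet_property n p C J I"
  unfolding meet_property_def
  by (metis Int_commute same_action_sym same_action_trans)

lemma meet_property_subset: "I \<subseteq> J \<Longrightarrow> meet_property n p C I J"
  unfolding meet_property_def by (metis inf.absorb_iff1 same_action_refl)

text \<open>
  A common element fixes every unit row, because no node lies in both sets, and so it is trivial.
\<close>

lemma meet_property_disjoint:
  assumes "I \<subseteq> {..<n}" "J \<subseteq> {..<n}" "I \<inter> J = {}"
  shows "meet_property n p C I J"
  unfolding meet_property_def
proof (intro allI impI)
  fix u w assume u: "set u \<subseteq> I" and w: "set w \<subseteq> J" and eq: "same_action n p C u w"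
  have "rows_cong n p (word_row C u (unit_row x)) (word_row C [] (unit_row x))" for x
  proof (cases "x \<in> I")
    case True
    with w assms have "x \<notin> set w" by auto
    from unit_row_fixed_mod[OF eq this] show ?thesis by simp
  next
    case False
    with u have "x \<notin> set u" by auto
    then show ?thesis by (simp add: word_row_fixes_unit_row)
  qed
  then have "same_action n p C u []"
    using assms u by (intro same_action_if_unit_rows) auto
  then show "\<exists>z. set z \<subseteq> I \<inter> J \<and> same_action n p C u z"
    by (intro exI[of _ "[]"]) auto
qed

text \<open>
  The commuting letter \<open>i\<close> can be moved to the end of a word, where its occurrences cancel in pairs.
\<close>

lemma split_off_commuting_node:
  assumes "C i i = 2" and "\<And>j. j \<in> I \<Longrightarrow> C i j = 0 \<and> C j i = 0"
    and "set u \<subseteq> insert i I"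
  obtains u' where "set u' \<subseteq> I"
    "(\<forall>v. word_row C u v = word_row C u' v) \<or>
     (\<forall>v. word_row C u v = reflect_row C i (word_row C u' v))"
proof -
  have "\<exists>u'. set u' \<subseteq> I \<and> ((\<forall>v. word_row C u v = word_row C u' v) \<or>
     (\<forall>v. word_row C u v = reflect_row C i (word_row C u' v)))"
    using assms(3)
  proof (induction u rule: rev_induct)
    case Nil
    show ?case by (intro exI[of _ "[]"]) auto
  next
    case (snoc j u)
    then obtain u' where u': "set u' \<subseteq> I" and
      eq: "(\<forall>v. word_row C u v = word_row C u' v) \<or>
        (\<forall>v. word_row C u v = reflect_row C i (word_row C u' v))" by auto
    show ?case
    proof (cases "j = i")
      case True
      then show ?thesis using u' eq assms(1)
        by (intro exI[of _ u']) (auto simp: reflect_row_involution)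
    next
      case False
      then have "j \<in> I" using snoc.prems by auto
      then show ?thesis using u' eq reflect_row_commute[of C j i] assms(2)
        by (intro exI[of _ "u' @ [j]"]) auto
    qed
  qed
  with that show thesis by blast
qed

lemma not_minus_one_cong_one:
  assumes "p \<ge> (3::nat)"
  shows "\<not> [- 1 = 1] (mod int p)"
proof
  assume "[- 1 = 1] (mod int p)"
  then have "int p dvd 2" by (simp add: cong_iff_dvd_diff)
  then have "int p \<le> 2" by (rule zdvd_imp_le) simp
  with assms show False by simp
qed

text \<open>
  Write the common element as \<open>h\<close> or \<open>h r\<^sub>i\<close> with \<open>h \<in> \<langle>I\<rangle>\<close>.  As \<open>h\<close> fixes \<open>e\<^sub>i\<close> while \<open>r\<^sub>i\<close> turns
  its \<open>i\<close>-th coordinate into \<open>- 1\<close>, the second form occurs only if \<open>i \<in> J\<close>, and then \<open>h\<close> lies in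
  \<open>\<langle>J\<rangle>\<close> as well.
\<close>

lemma meet_property_insert_commuting:
  assumes p: "p \<ge> 3" and I: "insert i I \<subseteq> {..<n}" and J: "J \<subseteq> {..<n}"
    and diag: "C i i = 2" and comm: "\<And>j. j \<in> I \<Longrightarrow> C i j = 0 \<and> C j i = 0"
    and meet: "meet_property n p C I J"
  shows "meet_property n p C (insert i I) J"
  unfolding meet_property_def
proof (intro allI impI)
  fix u w assume u: "set u \<subseteq> insert i I" and w: "set w \<subseteq> J" and eq: "same_action n p C u w"
  obtain u' where u': "set u' \<subseteq> I" and cases:
    "(\<forall>v. word_row C u v = word_row C u' v) \<or>
     (\<forall>v. word_row C u v = reflect_row C i (word_row C u' v))"
    using split_off_commuting_node[of C i I u] diag comm u by blast
  have iI: "i \<notin> I" using comm[of i] diag by auto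
  from cases show "\<exists>z. set z \<subseteq> insert i I \<inter> J \<and> same_action n p C u z"
  proof
    assume "\<forall>v. word_row C u v = word_row C u' v"
    then have uu': "same_action n p C u u'" by (simp add: same_action_def)
    then have "same_action n p C u' w" using eq same_action_sym same_action_trans by blast
    then obtain z where "set z \<subseteq> I \<inter> J" "same_action n p C u' z"
      using meet u' w unfolding meet_property_def by blast
    with uu' show ?thesis using same_action_trans by blast
  next
    assume u_eq: "\<forall>v. word_row C u v = reflect_row C i (word_row C u' v)"
    have "i \<in> J"
    proof (rule ccontr)
      assume "i \<notin> J"
      then have "rows_cong n p (word_row C u (unit_row i)) (unit_row i)"
        using unit_row_fixed_mod[OF eq] w by blast
      moreover have "word_row C u' (unit_row i) = unit_row i"
        using u' iI by (intro word_row_fixes_unit_row) auto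
      then have "word_row C u (unit_row i) i = - 1"
        using u_eq diag by (simp add: reflect_row_def unit_row_def)
      ultimately have "[- 1 = 1] (mod int p)"
        using I by (auto simp: rows_cong_def unit_row_def dest: spec[of _ i])
      with not_minus_one_cong_one[OF p] show False by blast
    qed
    have uu': "same_action n p C u (u' @ [i])" using u_eq by (simp add: same_action_def)
    have "same_action n p C u' (u @ [i])"
      using u_eq diag by (intro same_actionI) (simp add: reflect_row_involution)
    also have "same_action n p C (u @ [i]) (w @ [i])"
      using eq I by (intro same_action_append) auto
    finally obtain z where z: "set z \<subseteq> I \<inter> J" "same_action n p C u' z"
      using meet u' w \<open>i \<in> J\<close> unfolding meet_property_def
      by (metis Un_subset_iff empty_subsetI insert_subset list.set(1) list.simps(15) set_append)
    have "same_action n p C (u' @ [i]) (z @ [i])"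
      using z I by (intro same_action_append) auto
    with uu' have "same_action n p C u (z @ [i])" by (rule same_action_trans)
    then show ?thesis using z \<open>i \<in> J\<close> by (intro exI[of _ "z @ [i]"]) auto
  qed
qed

section \<open>Stabilisers of unit rows by coset enumeration\<close>

definition stabilizer_property ::
  "nat \<Rightarrow> nat \<Rightarrow> (nat \<Rightarrow> nat \<Rightarrow> int) \<Rightarrow> nat \<Rightarrow> nat set \<Rightarrow> bool" where
  "stabilizer_property n p C a K \<longleftrightarrow>
     (\<forall>u. set u \<subseteq> insert a K \<longrightarrow> rows_cong n p (word_row C u (unit_row a)) (unit_row a) \<longrightarrow>
        (\<exists>z. set z \<subseteq> K \<and> same_action n p C u z))"

text \<open>
  If multiplying a representative by a letter always leads to another representative or only produces a
  letter of \<open>K\<close> in front, then every word over \<open>insert a K\<close> is a word over \<open>K\<close> followed by a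
  representative.  Words over \<open>K\<close> fix \<open>e\<^sub>a\<close>, so the representative alone decides whether the
  word does.  The hypothesis \<open>closed\<close> has the form of Deodhar's lemma for shortest coset representatives.
\<close>

lemma stabilizer_property_by_cosets:
  assumes n: "insert a K \<subseteq> {..<n}" "a \<notin> K"
    and diag: "\<And>i. i \<in> insert a K \<Longrightarrow> C i i = 2"
    and reps: "[] \<in> T" "\<And>t. t \<in> T \<Longrightarrow> set t \<subseteq> {..<n}"
    and closed: "\<And>t s. t \<in> T \<Longrightarrow> s \<in> insert a K \<Longrightarrow>
      t @ [s] \<in> T \<or> (\<exists>t'\<in>T. t = t' @ [s]) \<or> (\<exists>t'\<in>T. same_action n p C (t @ [s]) t') \<or>
      (\<exists>r\<in>K. same_action n p C (t @ [s]) (r # t))"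
    and moved: "\<And>t. t \<in> T \<Longrightarrow> t \<noteq> [] \<Longrightarrow> \<not> rows_cong n p (word_row C t (unit_row a)) (unit_row a)"
  shows "stabilizer_property n p C a K"
  unfolding stabilizer_property_def
proof (intro allI impI)
  fix w assume w: "set w \<subseteq> insert a K"
    and fixed: "rows_cong n p (word_row C w (unit_row a)) (unit_row a)"
  have step: "\<exists>u t'. set u \<subseteq> K \<and> t' \<in> T \<and> same_action n p C (t @ [s]) (u @ t')"
    if "t \<in> T" "s \<in> insert a K" for t s
    using closed[OF that]
  proof (elim disjE bexE)
    assume "t @ [s] \<in> T"
    then show ?thesis by (intro exI[of _ "[]"] exI[of _ "t @ [s]"]) auto
  next
    fix t' assume "t' \<in> T" "t = t' @ [s]"
    then have "same_action n p C (t @ [s]) t'"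
      using diag that by (intro same_actionI) (simp add: reflect_row_involution)
    with \<open>t' \<in> T\<close> show ?thesis by (intro exI[of _ "[]"] exI[of _ t']) auto
  next
    fix t' assume "t' \<in> T" "same_action n p C (t @ [s]) t'"
    then show ?thesis by (intro exI[of _ "[]"] exI[of _ t']) auto
  next
    fix r assume "r \<in> K" "same_action n p C (t @ [s]) (r # t)"
    then show ?thesis using that by (intro exI[of _ "[r]"] exI[of _ t]) auto
  qed
  have "\<exists>u t. set u \<subseteq> K \<and> t \<in> T \<and> same_action n p C w (u @ t)"
    using w
  proof (induction w rule: rev_induct)
    case Nil
    show ?case using reps by (intro exI[of _ "[]"]) auto
  next
    case (snoc s w)
    then obtain u t where ut: "set u \<subseteq> K" "t \<in> T" "same_action n p C w (u @ t)" by auto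
    with snoc.prems obtain u' t' where ut': "set u' \<subseteq> K" "t' \<in> T" 
      "same_action n p C (t @ [s]) (u' @ t')" using step[of t s] by auto
    have "same_action n p C (w @ [s]) ((u @ t) @ [s])"
      using ut snoc.prems n by (intro same_action_append) auto
    also have "same_action n p C (u @ (t @ [s])) (u @ (u' @ t'))"
      using ut' reps n by (intro same_action_append[OF same_action_refl]) auto
    then have "same_action n p C ((u @ t) @ [s]) (u @ (u' @ t'))" by simp
    finally show ?case using ut ut' by (intro exI[of _ "u @ u'"] exI[of _ t']) auto
  qed
  then obtain u t where ut: "set u \<subseteq> K" "t \<in> T" "same_action n p C w (u @ t)" by blast
  have "word_row C u (unit_row a) = unit_row a"
    using ut n by (intro word_row_fixes_unit_row) auto
  then have "rows_cong n p (word_row C w (unit_row a)) (word_row C t (unit_row a))"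
    using ut(3) by (auto simp: same_action_def dest: spec[of _ "unit_row a"])
  then have "rows_cong n p (word_row C t (unit_row a)) (unit_row a)"
    using fixed rows_cong_sym rows_cong_trans by blast
  with moved ut have "t = []" by blast
  with ut show "\<exists>z. set z \<subseteq> K \<and> same_action n p C w z" by auto
qed

lemma meet_property_by_stabilizer:
  assumes "stabilizer_property n p C a K" "a \<notin> J" "K \<subseteq> J"
  shows "meet_property n p C (insert a K) J"
  unfolding meet_property_def
proof (intro allI impI)
  fix u w assume u: "set u \<subseteq> insert a K" and w: "set w \<subseteq> J" and eq: "same_action n p C u w"
  have "rows_cong n p (word_row C u (unit_row a)) (unit_row a)"
    using unit_row_fixed_mod[OF eq] w assms by blast
  with assms u obtain z where "set z \<subseteq> K" "same_action n p C u z"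
    unfolding stabilizer_property_def by blast
  with assms show "\<exists>z. set z \<subseteq> insert a K \<inter> J \<and> same_action n p C u z" by blast
qed

text \<open>
  The possible pairs \<open>(c\<^sub>i\<^sub>j, c\<^sub>j\<^sub>i)\<close> of Cartan integers of neighbouring nodes.
\<close>

definition crystallographic_pair :: "int \<Rightarrow> int \<Rightarrow> bool" where
  "crystallographic_pair x y \<longleftrightarrow> x = 0 \<and> y = 0 \<or> x < 0 \<and> y < 0 \<and> x * y \<le> 4"

lemma crystallographic_pair_cases:
  assumes "crystallographic_pair x y"
  shows "(x, y) \<in> {(0, 0), (-1, -1), (-1, -2), (-2, -1), (-1, -3), (-3, -1), (-1, -4), (-2, -2), (-4, -1)}"
proof (cases "x = 0")
  case True
  with assms show ?thesis by (simp add: crystallographic_pair_def)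
next
  case False
  with assms have neg: "x < 0" "y < 0" "x * y \<le> 4" by (auto simp: crystallographic_pair_def)
  have "- x * 1 \<le> - x * - y" "1 * - y \<le> - x * - y"
    using neg by (intro mult_left_mono mult_right_mono; simp)+
  with neg have "x \<in> {-4..-1}" "y \<in> {-4..-1}" by auto
  then have "x = -1 \<or> x = -2 \<or> x = -3 \<or> x = -4" "y = -1 \<or> y = -2 \<or> y = -3 \<or> y = -4"
    by auto
  with neg(3) show ?thesis by auto
qed

lemma crystallographic_pair_sym: "crystallographic_pair x y \<Longrightarrow> crystallographic_pair y x"
  by (auto simp: crystallographic_pair_def mult.commute)

lemma not_rows_congI:
  assumes "j < n" "\<not> int p dvd v j - w j"
  shows "\<not> rows_cong n p v w"
  using assms by (auto simp: rows_cong_def cong_iff_dvd_diff)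

lemma small_not_dvd:
  assumes "p \<ge> (3::nat)"
  shows "\<not> int p dvd 1" "\<not> int p dvd 2" "\<not> int p dvd -1" "\<not> int p dvd -2"
proof -
  have "\<not> int p \<le> 2" "\<not> int p \<le> 1" using assms by auto
  then show "\<not> int p dvd 1" "\<not> int p dvd 2" using zdvd_imp_le[of "int p"] by fastforce+
  then show "\<not> int p dvd -1" "\<not> int p dvd -2" by simp_all
qed

text \<open>
  Modulo \<open>p\<close> the braid relation needs the product of the two Cartan integers only modulo \<open>p\<close>.  This
  covers the mark 3 and, for \<open>p = 3\<close>, the mark \<open>\<infinity>\<close>, where the product is 4.
\<close>

lemma braid_length_3_mod:
  assumes "C a a = 2" "C b b = 2" "[C a b * C b a = 1] (mod int p)"
  shows "same_action n p C [a, b, a] [b, a, b]"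
  unfolding same_action_def rows_cong_def
proof (intro allI impI)
  fix v :: "nat \<Rightarrow> int" and j
  have "word_row C [a, b, a] v j - word_row C [b, a, b] v j =
      (1 - C a b * C b a) * (v a * C a j - v b * C b j)"
    using assms(1,2) by (simp add: reflect_row_def algebra_simps)
  moreover have "int p dvd 1 - C a b * C b a"
    using assms(3) by (metis cong_iff_dvd_diff cong_sym)
  ultimately show "[word_row C [a, b, a] v j = word_row C [b, a, b] v j] (mod int p)"
    by (simp add: cong_iff_dvd_diff)
qed

lemma stabilizer_property_commuting:
  assumes p: "p \<ge> 3" and n: "insert a K \<subseteq> {..<n}" "a \<notin> K"
    and diag: "\<And>i. i \<in> insert a K \<Longrightarrow> C i i = 2"
    and comm: "\<And>i. i \<in> K \<Longrightarrow> C a i = 0 \<and> C i a = 0"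
  shows "stabilizer_property n p C a K"
proof (rule stabilizer_property_by_cosets[where T = "{[], [a]}"])
  fix t s assume "t \<in> {[], [a]}" "s \<in> insert a K"
  moreover have "same_action n p C [a, s] [s, a]" if "s \<in> K"
    using comm[OF that] by (intro same_actionI) (simp add: reflect_row_commute)
  ultimately show "t @ [s] \<in> {[], [a]} \<or> (\<exists>t'\<in>{[], [a]}. t = t' @ [s]) \<or>
      (\<exists>t'\<in>{[], [a]}. same_action n p C (t @ [s]) t') \<or>
      (\<exists>r\<in>K. same_action n p C (t @ [s]) (r # t))"
    by (cases "s \<in> K") (auto intro: bexI[of _ s])
next
  fix t assume t: "t \<in> {[], [a]}" "t \<noteq> []"
  show "\<not> rows_cong n p (word_row C t (unit_row a)) (unit_row a)"
    using t n diag small_not_dvd[OF p]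
    by (intro not_rows_congI[of a]) (auto simp: reflect_row_def unit_row_def)
qed (use n diag in auto)

text \<open>
  The rows \<open>e\<^sub>a t\<close> for the alternating words \<open>t = a, ab, aba, \<dots>\<close> either have a coordinate at \<open>a\<close> different
  from 1 modulo \<open>p\<close>, or their coordinate at \<open>b\<close> is \<open>\<plusminus> C a b\<close>.  Hence the condition that \<open>p\<close> does not
  divide \<open>C a b\<close>: for the mark 6, \<open>p = 3\<close> and \<open>C a b = - 3\<close> the row of \<open>abab\<close> is \<open>e\<^sub>a\<close> again.
\<close>

lemma stabilizer_property_dihedral:
  assumes p: "p \<ge> 3" and n: "a < n" "b < n" "a \<noteq> b" and diag: "C a a = 2" "C b b = 2"
    and mark: "[C a b * C b a = 1] (mod int p) \<or>
      crystallographic_pair (C a b) (C b a) \<and> C a b * C b a \<le> 3 \<and> (C a b = 0 \<or> \<not> int p dvd C a b)"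
  shows "stabilizer_property n p C a {b}"
proof -
  consider (3) "[C a b * C b a = 1] (mod int p)" | (2) "C a b = 0" "C b a = 0"
    | (4) "C a b * C b a = 2" "C a b = -1 \<and> C b a = -2 \<or> C a b = -2 \<and> C b a = -1" "\<not> int p dvd C a b"
    | (6) "C a b * C b a = 3" "C a b = -1 \<and> C b a = -3 \<or> C a b = -3 \<and> C b a = -1" "\<not> int p dvd C a b"
    using mark crystallographic_pair_cases[of "C a b" "C b a"] by auto
  then show ?thesis
  proof cases
    case 2
    then show ?thesis using assms by (intro stabilizer_property_commuting) auto
  next
    case 3
    have relation: "same_action n p C [a, b, a] [b, a, b]"
      using braid_length_3_mod[OF diag 3] .
    have "\<not> int p dvd C a b * C b a - 2"
    proof
      assume "int p dvd C a b * C b a - 2"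
      then have "[C a b * C b a = 2] (mod int p)" by (simp add: cong_iff_dvd_diff)
      with 3 have "[1 = 2] (mod int p)" using cong_sym cong_trans by blast
      then show False using small_not_dvd[OF p] by (simp add: cong_iff_dvd_diff)
    qed
    moreover have "word_row C [a] (unit_row a) a - unit_row a a = -2"
      "word_row C [a, b] (unit_row a) a - unit_row a a = C a b * C b a - 2"
      using n diag by (simp_all add: reflect_row_def unit_row_def)
    ultimately have "\<not> rows_cong n p (word_row C [a] (unit_row a)) (unit_row a)"
      "\<not> rows_cong n p (word_row C [a, b] (unit_row a)) (unit_row a)"
      using n small_not_dvd[OF p] by (metis not_rows_congI)+
    then show ?thesis
      using n diag relation
      by (intro stabilizer_property_by_cosets[where T = "{[], [a], [a, b]}"]) auto
  next
    case 4
    have relation: "same_action n p C [a, b, a, b] [b, a, b, a]"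
      using 4(2) diag
      by (intro same_actionI ext) (elim disjE; simp add: reflect_row_def algebra_simps)
    show ?thesis
    proof (rule stabilizer_property_by_cosets[where T = "{[], [a], [a, b], [a, b, a]}"])
      fix t assume "t \<in> {[], [a], [a, b], [a, b, a]}" "t \<noteq> []"
      then consider "t = [a]" | "t = [a, b]" | "t = [a, b, a]" by auto
      then show "\<not> rows_cong n p (word_row C t (unit_row a)) (unit_row a)"
      proof cases
        case 1
        then show ?thesis using n diag 4 small_not_dvd[OF p]
          by (intro not_rows_congI[of a]) (auto simp: reflect_row_def unit_row_def)
      next
        case 2
        then show ?thesis using n diag 4
          by (intro not_rows_congI[of b]) (auto simp: reflect_row_def unit_row_def)
      next
        case 3
        then show ?thesis using n diag 4 small_not_dvd[OF p]
          by (intro not_rows_congI[of a]) (auto simp: reflect_row_def unit_row_def)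
      qed
    qed (use n diag in \<open>auto simp: relation\<close>)
  next
    case 6
    have relation: "same_action n p C [a, b, a, b, a, b] [b, a, b, a, b, a]"
      using 6(2) diag
      by (intro same_actionI ext) (elim disjE; simp add: reflect_row_def algebra_simps)
    let ?T = "{[], [a], [a, b], [a, b, a], [a, b, a, b], [a, b, a, b, a]}"
    show ?thesis
    proof (rule stabilizer_property_by_cosets[where T = ?T])
      fix t assume "t \<in> ?T" "t \<noteq> []"
      then consider "t \<in> {[a], [a, b, a, b, a]}" | "t \<in> {[a, b], [a, b, a], [a, b, a, b]}" by auto
      then show "\<not> rows_cong n p (word_row C t (unit_row a)) (unit_row a)"
      proof cases
        case 1
        then show ?thesis using n diag 6 small_not_dvd[OF p]
          by (intro not_rows_congI[of a]) (auto simp: reflect_row_def unit_row_def)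
      next
        case 2
        then show ?thesis using n diag 6
          by (intro not_rows_congI[of b]) (auto simp: reflect_row_def unit_row_def)
      qed
    qed (use n diag in \<open>auto simp: relation\<close>)
  qed
qed

text \<open>
  The four cosets of a parabolic subgroup of type \<open>A\<^sub>2\<close> in type \<open>A\<^sub>3\<close>.
\<close>

lemma stabilizer_property_3_3:
  assumes p: "p \<ge> 3" and n: "a < n" "b < n" "c < n" "a \<noteq> b" "a \<noteq> c" "b \<noteq> c"
    and diag: "C a a = 2" "C b b = 2" "C c c = 2" and ac: "C a c = 0" "C c a = 0"
    and ab: "C a b = -1" "C b a = -1" and bc: "C b c = -1" "C c b = -1"
  shows "stabilizer_property n p C a {b, c}"
proof (rule stabilizer_property_by_cosets[where T = "{[], [a], [a, b], [a, b, c]}"])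
  note expand = reflect_row_def diag ac ab bc algebra_simps
  let ?A = "reflect_row C a" and ?B = "reflect_row C b" and ?C = "reflect_row C c"
  have "?A (?C v) = ?C (?A v)" "?B (?A (?B v)) = ?A (?B (?A v))" "?B (?C (?B v)) = ?C (?B (?C v))" for v
    by (intro ext; simp add: expand)+
  then have relations: "same_action n p C [a, c] [c, a]" "same_action n p C [a, b, a] [b, a, b]"
    "same_action n p C [a, b, c, a] [b, a, b, c]" "same_action n p C [a, b, c, b] [c, a, b, c]"
    by (intro same_actionI; simp)+
  fix t s assume "t \<in> {[], [a], [a, b], [a, b, c]}" "s \<in> {a, b, c}"
  then show "t @ [s] \<in> {[], [a], [a, b], [a, b, c]} \<or>
      (\<exists>t'\<in>{[], [a], [a, b], [a, b, c]}. t = t' @ [s]) \<or>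
      (\<exists>t'\<in>{[], [a], [a, b], [a, b, c]}. same_action n p C (t @ [s]) t') \<or>
      (\<exists>r\<in>{b, c}. same_action n p C (t @ [s]) (r # t))"
      using n(4-6) by (elim insertE emptyE; simp add: relations)
next
  fix t assume "t \<in> {[], [a], [a, b], [a, b, c]}" "t \<noteq> []"
  with n diag ab ac bc small_not_dvd[OF p]
  show "\<not> rows_cong n p (word_row C t (unit_row a)) (unit_row a)"
    by (intro not_rows_congI[of a]) (auto simp: reflect_row_def unit_row_def)
qed (use n diag in auto)

text \<open>
  The six cosets of a parabolic subgroup of type \<open>B\<^sub>2\<close> in type \<open>B\<^sub>3\<close>: the vertices of the octahedron.
\<close>

lemma stabilizer_property_3_4:
  assumes p: "p \<ge> 3" and n: "a < n" "b < n" "c < n" "a \<noteq> b" "a \<noteq> c" "b \<noteq> c"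
    and diag: "C a a = 2" "C b b = 2" "C c c = 2" and ac: "C a c = 0" "C c a = 0"
    and ab: "C a b = -1" "C b a = -1"
    and bc: "C b c = -1 \<and> C c b = -2 \<or> C b c = -2 \<and> C c b = -1"
  shows "stabilizer_property n p C a {b, c}"
proof -
  let ?T = "{[], [a], [a, b], [a, b, c], [a, b, c, b], [a, b, c, b, a]}"
  note expand = reflect_row_def diag ac ab algebra_simps
  let ?A = "reflect_row C a" and ?B = "reflect_row C b" and ?C = "reflect_row C c"
  have "?A (?C v) = ?C (?A v)" "?B (?A (?B v)) = ?A (?B (?A v))" for v
    by (intro ext; simp add: expand)+
  moreover have "?B (?C (?B (?C v))) = ?C (?B (?C (?B v)))" for v
    using bc by (intro ext; elim disjE; simp add: expand)
  ultimately have relations: "same_action n p C [a, c] [c, a]" "same_action n p C [a, b, a] [b, a, b]"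
    "same_action n p C [a, b, c, a] [b, a, b, c]" "same_action n p C [a, b, c, b, c] [c, a, b, c, b]"
    "same_action n p C [a, b, c, b, a, b] [b, a, b, c, b, a]"
    "same_action n p C [a, b, c, b, a, c] [c, a, b, c, b, a]"
    by (intro same_actionI; simp)+
  show ?thesis
  proof (rule stabilizer_property_by_cosets[where T = ?T])
    fix t s assume "t \<in> ?T" "s \<in> {a, b, c}"
    then show "t @ [s] \<in> ?T \<or> (\<exists>t'\<in>?T. t = t' @ [s]) \<or>
        (\<exists>t'\<in>?T. same_action n p C (t @ [s]) t') \<or> (\<exists>r\<in>{b, c}. same_action n p C (t @ [s]) (r # t))"
      using n(4-6) by (elim insertE emptyE; simp add: relations)
  next
    fix t assume "t \<in> ?T" "t \<noteq> []"
    then consider "t \<in> {[a], [a, b], [a, b, c], [a, b, c, b, a]}" | "t = [a, b, c, b]" by auto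
    then show "\<not> rows_cong n p (word_row C t (unit_row a)) (unit_row a)"
    proof cases
      case 1
      with n diag ab ac bc small_not_dvd[OF p] show ?thesis
        by (intro not_rows_congI[of a]) (auto simp: reflect_row_def unit_row_def)
    next
      case 2
      with n diag ab ac bc small_not_dvd[OF p] show ?thesis
        by (intro not_rows_congI[of b]) (auto simp: reflect_row_def unit_row_def)
    qed
  qed (use n diag in auto)
qed

text \<open>
  The eight cosets of a parabolic subgroup of type \<open>A\<^sub>2\<close> in type \<open>B\<^sub>3\<close>: the vertices of the cube.
\<close>

lemma stabilizer_property_4_3:
  assumes p: "p \<ge> 3" and n: "a < n" "b < n" "c < n" "a \<noteq> b" "a \<noteq> c" "b \<noteq> c"
    and diag: "C a a = 2" "C b b = 2" "C c c = 2" and ac: "C a c = 0" "C c a = 0"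
    and ab: "C a b = -1 \<and> C b a = -2 \<or> C a b = -2 \<and> C b a = -1"
    and bc: "C b c = -1" "C c b = -1"
  shows "stabilizer_property n p C a {b, c}"
proof -
  let ?T = "{[], [a], [a, b], [a, b, a], [a, b, c], [a, b, a, c], [a, b, a, c, b], [a, b, a, c, b, a]}"
  note expand = reflect_row_def diag ac bc algebra_simps
  let ?A = "reflect_row C a" and ?B = "reflect_row C b" and ?C = "reflect_row C c"
  have AC: "?A (?C v) = ?C (?A v)" and BC: "?B (?C (?B v)) = ?C (?B (?C v))" for v
    by (intro ext; simp add: expand)+
  have AB: "?A (?B (?A (?B v))) = ?B (?A (?B (?A v)))" for v
    using ab by (intro ext; elim disjE; simp add: expand)
  have AA: "?A (?A v) = v" for v
    using diag by (simp add: reflect_row_involution)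
  have relations: "same_action n p C [a, c] [c, a]" "same_action n p C [a, b, a, b] [b, a, b, a]"
    "same_action n p C [a, b, c, a] [a, b, a, c]" "same_action n p C [a, b, c, b] [c, a, b, c]"
    "same_action n p C [a, b, a, c, a] [a, b, c]"
    "same_action n p C [a, b, a, c, b, c] [b, a, b, a, c, b]"
    "same_action n p C [a, b, a, c, b, a, c] [b, a, b, a, c, b, a]"
    by (intro same_actionI; simp add: AC BC AB AA)+
  \<comment> \<open>The braid relations, read as rewrite rules, are not confluent; this relation needs them in both directions.\<close>
  have last_relation: "same_action n p C [a, b, a, c, b, a, b] [c, a, b, a, c, b, a]"
  proof (rule same_actionI)
    fix v
    have "?B (?A (?B (?C (?A (?B (?A v)))))) = ?B (?A (?B (?A (?C (?B (?A v))))))"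
      by (simp only: AC)
    also have "\<dots> = ?A (?B (?A (?B (?C (?B (?A v))))))" by (simp only: AB)
    also have "\<dots> = ?A (?B (?A (?C (?B (?C (?A v))))))" by (simp only: BC)
    also have "\<dots> = ?A (?B (?C (?A (?B (?A (?C v))))))" by (simp only: AC)
    finally show "word_row C [a, b, a, c, b, a, b] v = word_row C [c, a, b, a, c, b, a] v" by simp
  qed
  show ?thesis
  proof (rule stabilizer_property_by_cosets[where T = ?T])
    fix t s assume "t \<in> ?T" "s \<in> {a, b, c}"
    then show "t @ [s] \<in> ?T \<or> (\<exists>t'\<in>?T. t = t' @ [s]) \<or>
        (\<exists>t'\<in>?T. same_action n p C (t @ [s]) t') \<or> (\<exists>r\<in>{b, c}. same_action n p C (t @ [s]) (r # t))"
      using n(4-6) by (elim insertE emptyE; simp add: relations last_relation)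
  next
    fix t assume "t \<in> ?T" "t \<noteq> []"
    then consider "t \<in> {[a], [a, b, a], [a, b, a, c], [a, b, a, c, b, a]}"
      | "t \<in> {[a, b], [a, b, a, c, b]}" | "t = [a, b, c]" by auto
    then show "\<not> rows_cong n p (word_row C t (unit_row a)) (unit_row a)"
    proof cases
      case 1
      with n diag ab ac bc small_not_dvd[OF p] show ?thesis
        by (intro not_rows_congI[of a]) (auto simp: reflect_row_def unit_row_def)
    next
      case 2
      with n diag ab ac bc small_not_dvd[OF p] show ?thesis
        by (intro not_rows_congI[of b]) (auto simp: reflect_row_def unit_row_def)
    next
      case 3
      with n diag ab ac bc small_not_dvd[OF p] show ?thesis
        by (intro not_rows_congI[of c]) (auto simp: reflect_row_def unit_row_def)
    qed
  qed (use n diag in auto)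
qed

section \<open>The critical intersections along a path of four nodes\<close>

text \<open>
  Modulo 3 a reflection at \<open>x\<close> changes neither of the coordinates \<open>y\<close> and \<open>c\<close>, and the one at \<open>c\<close> sends
  \<open>(v\<^sub>y, v\<^sub>c)\<close> to \<open>(v\<^sub>y + v\<^sub>c, - v\<^sub>c)\<close>, which changes \<open>v\<^sub>y - v\<^sub>c + 1\<close> by \<open>3 v\<^sub>c\<close>.
  So this expression stays divisible by 3.
\<close>

lemma row_functional_mod_3:
  assumes u: "set u \<subseteq> {x, c}" and yc: "y \<noteq> c"
    and C: "C c c = 2" "C x c = -3" "C x y = 0" "C c y = -1"
  shows "[word_row C u (unit_row c) y = word_row C u (unit_row c) c - 1] (mod 3)"
    and "[word_row C u (unit_row c) c = 1] (mod 3) \<or> [word_row C u (unit_row c) c = -1] (mod 3)"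
proof -
  have "[word_row C u (unit_row c) y = word_row C u (unit_row c) c - 1] (mod 3) \<and>
      ([word_row C u (unit_row c) c = 1] (mod 3) \<or> [word_row C u (unit_row c) c = -1] (mod 3))"
    using u
  proof (induction u rule: rev_induct)
    case Nil
    show ?case using yc by (simp add: unit_row_def)
  next
    case (snoc i u)
    define v where "v = word_row C u (unit_row c)"
    have IH: "[v y = v c - 1] (mod 3)" "[v c = 1] (mod 3) \<or> [v c = -1] (mod 3)"
      using snoc by (simp_all add: v_def)
    have last: "word_row C (u @ [i]) (unit_row c) j = v j - v i * C i j" for j
      by (simp add: v_def) (simp only: reflect_row_def)
    have "i = x \<or> i = c" using snoc.prems by auto
    then show ?case
    proof
      assume i: "i = x"
      have c': "[v c + 3 * v x = v c] (mod 3)" by (simp add: cong_iff_dvd_diff)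
      have "[v y = v c + 3 * v x - 1] (mod 3)"
        using IH(1) cong_diff[OF cong_sym[OF c'] cong_refl[of 1]] by (rule cong_trans)
      moreover have "[v c + 3 * v x = 1] (mod 3) \<or> [v c + 3 * v x = -1] (mod 3)"
        using IH(2) cong_trans[OF c'] by blast
      ultimately show ?thesis
        unfolding last using C i by (simp add: mult.commute)
    next
      assume i: "i = c"
      have "[v y + v c = v c - 1 + v c] (mod 3)" using IH(1) by (rule cong_add) simp
      also have "[v c - 1 + v c = - v c - 1] (mod 3)" by (simp add: cong_iff_dvd_diff)
      finally have "[v y + v c = - v c - 1] (mod 3)" .
      moreover have "[- v c = 1] (mod 3) \<or> [- v c = -1] (mod 3)"
        using IH(2) cong_minus_minus_iff[of "v c" 1 3] cong_minus_minus_iff[of "v c" "-1" 3] by auto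
      ultimately show ?thesis unfolding last using C i by simp
    qed
  qed
  then show "[word_row C u (unit_row c) y = word_row C u (unit_row c) c - 1] (mod 3)"
    and "[word_row C u (unit_row c) c = 1] (mod 3) \<or> [word_row C u (unit_row c) c = -1] (mod 3)"
    by blast+
qed

text \<open>
  Here \<open>\<langle>b, c\<rangle>\<close> and \<open>\<langle>c, d\<rangle>\<close> contain elements of order 3 that fix \<open>e\<^sub>b\<close> and \<open>e\<^sub>d\<close> respectively, so stabilisers
  are of no use.  A common element fixes every unit row but \<open>e\<^sub>c\<close>.  By
  \<open>row_functional_mod_3\<close>, applied to \<open>\<langle>b, c\<rangle>\<close> and to \<open>\<langle>c, d\<rangle>\<close>, the coordinates of the image of \<open>e\<^sub>c\<close> at
  \<open>d\<close> and at \<open>b\<close> are determined by the one at \<open>c\<close>, which is \<open>\<plusminus> 1\<close>.  The two possibilities are the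
  identity and \<open>r\<^sub>c\<close>.
\<close>

lemma meet_property_6_6_mod_3:
  assumes n: "b < n" "c < n" "d < n" and dist: "b \<noteq> c" "b \<noteq> d" "c \<noteq> d"
    and diag: "C c c = 2" and bd: "C b d = 0" "C d b = 0"
    and six: "C b c = -3" "C c b = -1" "C d c = -3" "C c d = -1"
    and other: "\<And>j. j < n \<Longrightarrow> j \<notin> {b, c, d} \<Longrightarrow> C c j = 0 \<and> C d j = 0"
  shows "meet_property n 3 C {b, c} {c, d}"
  unfolding meet_property_def
proof (intro allI impI)
  fix u w assume u: "set u \<subseteq> {b, c}" and w: "set w \<subseteq> {c, d}" and eq: "same_action n 3 C u w"
  define v where "v = word_row C u (unit_row c)"
  define v' where "v' = word_row C w (unit_row c)"
  have vv': "[v j = v' j] (mod 3)" if "j < n" for j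
    using eq that by (auto simp: same_action_def rows_cong_def v_def v'_def)
  have v_d: "[v d = v c - 1] (mod 3)"
    unfolding v_def using u dist diag bd six by (intro row_functional_mod_3(1)[of u b]) auto
  have v_c: "[v c = 1] (mod 3) \<or> [v c = -1] (mod 3)"
    unfolding v_def using u dist diag bd six by (intro row_functional_mod_3(2)[of u b c d]) auto
  have "[v' b = v' c - 1] (mod 3)"
    unfolding v'_def using w dist diag bd six by (intro row_functional_mod_3(1)[of w d]) auto
  with vv'[OF n(1)] have "[v b = v' c - 1] (mod 3)" by (rule cong_trans)
  also have "[v' c - 1 = v c - 1] (mod 3)"
    using cong_sym[OF vv'[OF n(2)]] by (rule cong_diff) simp
  finally have v_b: "[v b = v c - 1] (mod 3)" .
  have "word_row C w (unit_row c) j = 0" if "j < n" "j \<notin> {b, c, d}" for j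
    using w
  proof (induction w rule: rev_induct)
    case Nil
    then show ?case using that by (simp add: unit_row_def)
  next
    case (snoc i w)
    then show ?case using other[OF that] by (auto simp: reflect_row_def)
  qed
  then have v_other: "[v j = 0] (mod 3)" if "j < n" "j \<notin> {b, c, d}" for j
    using vv'[of j] that by (simp add: v'_def)
  have fixed: "rows_cong n 3 (word_row C u (unit_row x)) (unit_row x)" if "x \<noteq> c" for x
  proof (cases "x = b")
    case True
    then have "x \<notin> set w" using w dist by auto
    then show ?thesis using unit_row_fixed_mod[OF eq] by blast
  next
    case False
    then have "x \<notin> set u" using u that by auto
    then show ?thesis by (simp add: word_row_fixes_unit_row)
  qed
  have same: "same_action n 3 C u z" 
    if "set z \<subseteq> {c}" "rows_cong n 3 v (word_row C z (unit_row c))" for z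
  proof (rule same_action_if_unit_rows)
    fix x assume "x < n"
    show "rows_cong n 3 (word_row C u (unit_row x)) (word_row C z (unit_row x))"
    proof (cases "x = c")
      case True
      then show ?thesis using that by (simp add: v_def)
    next
      case False
      then have "x \<notin> set z" using that by auto
      then show ?thesis using fixed[OF False] by (simp add: word_row_fixes_unit_row)
    qed
  qed (use u n that in auto)
  from v_c show "\<exists>z. set z \<subseteq> {b, c} \<inter> {c, d} \<and> same_action n 3 C u z"
  proof
    assume c: "[v c = 1] (mod 3)"
    have "[v b = 0] (mod 3)" "[v d = 0] (mod 3)"
      using cong_trans[OF v_b cong_diff[OF c cong_refl[of 1]]]
        cong_trans[OF v_d cong_diff[OF c cong_refl[of 1]]] by simp_all
    with c v_other have "[v j = unit_row c j] (mod 3)" if "j < n" for j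
      using that dist by (cases "j \<in> {b, c, d}") (auto simp: unit_row_def)
    then have "rows_cong n 3 v (unit_row c)"
      by (simp add: rows_cong_def)
    then show ?thesis using same[of "[]"] by (intro exI[of _ "[]"]) auto
  next
    assume c: "[v c = -1] (mod 3)"
    have "[- 1 - 1 = 1] (mod (3 :: int))" by (simp add: cong_iff_dvd_diff)
    then have "[v c - 1 = 1] (mod 3)"
      using cong_trans[OF cong_diff[OF c cong_refl]] by blast
    then have "[v b = 1] (mod 3)" "[v d = 1] (mod 3)"
      using cong_trans[OF v_b] cong_trans[OF v_d] by blast+
    have "[v j = word_row C [c] (unit_row c) j] (mod 3)" if "j < n" for j
    proof (cases "j \<in> {b, c, d}")
      case True
      then show ?thesis using c \<open>[v b = 1] (mod 3)\<close> \<open>[v d = 1] (mod 3)\<close> dist diag six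
        by (auto simp: unit_row_def reflect_row_def)
    next
      case False
      then show ?thesis using v_other[OF that] other[OF that]
        by (simp add: unit_row_def reflect_row_def)
    qed
    then have "rows_cong n 3 v (word_row C [c] (unit_row c))"
      by (simp add: rows_cong_def)
    then show ?thesis using same[of "[c]"] by (intro exI[of _ "[c]"]) auto
  qed
qed

text \<open>
  The stabiliser of the unit row at either end of the path can be used; the case distinctions serve to
  avoid the one that is too large when a mark is 6 and \<open>p = 3\<close>.
\<close>

lemma meet_properties_of_path:
  assumes p: "p \<ge> 3" and dist: "distinct [a, b, c, d]" and nodes: "{a, b, c, d} = {..<n}"
    and diag: "\<And>i. i < n \<Longrightarrow> C i i = 2"
    and far: "C a c = 0" "C c a = 0" "C a d = 0" "C d a = 0" "C b d = 0" "C d b = 0"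
    and ab: "crystallographic_pair (C a b) (C b a)"
    and bc: "crystallographic_pair (C b c) (C c b)"
    and cd: "crystallographic_pair (C c d) (C d c)"
    and spherical: "C a b * C b a + C b c * C c b \<le> 3"
  shows "meet_property n p C {a, b, c} {b, c, d}"
    and "meet_property n p C {a, b} {b, c}"
    and "meet_property n p C {b, c} {c, d}"
proof -
  have n: "a < n" "b < n" "c < n" "d < n" using nodes by auto
  note diag' = diag[OF n(1)] diag[OF n(2)] diag[OF n(3)] diag[OF n(4)]
  note cases = crystallographic_pair_cases[OF ab] crystallographic_pair_cases[OF bc]
    crystallographic_pair_cases[OF cd]
  note ndvd = small_not_dvd[OF p]
  have dvd_3: "p = 3" if "int p dvd -3"
    using that zdvd_imp_le[of "int p" 3] p by simp
  \<comment> \<open>If the branch between \<open>b\<close> and \<open>c\<close> is missing, then \<open>c\<close> splits off on the left and \<open>b\<close> on the right.\<close>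
  show "meet_property n p C {a, b, c} {b, c, d}"
  proof (cases "C b c = 0")
    case True
    then have "C c b = 0" using bc by (auto simp: crystallographic_pair_def)
    have "meet_property n p C {c, d} {a, b}"
      using n dist by (intro meet_property_disjoint) auto
    then have "meet_property n p C {b, c, d} {a, b}"
      using n far diag' True \<open>C c b = 0\<close>
      by (intro meet_property_insert_commuting[OF p, of b "{c, d}"]) auto
    then have "meet_property n p C {a, b} {b, c, d}" by (rule meet_property_sym)
    then have "meet_property n p C (insert c {a, b}) {b, c, d}"
      using n far diag' True \<open>C c b = 0\<close>
      by (intro meet_property_insert_commuting[OF p, of c "{a, b}"]) auto
    then show ?thesis by (simp add: insert_commute)
  next
    case False
    have "stabilizer_property n p C a {b, c}"
    proof (cases "C a b = 0")
      case True
      then have "C b a = 0" using ab by (auto simp: crystallographic_pair_def)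
      then show ?thesis using True n dist far diag'
        by (intro stabilizer_property_commuting[OF p]) auto
    next
      case nz: False
      consider (A) "C a b = -1" "C b a = -1" "C b c = -1" "C c b = -1"
        | (B) "C a b = -1" "C b a = -1" "C b c = -1 \<and> C c b = -2 \<or> C b c = -2 \<and> C c b = -1"
        | (D) "C b c = -1" "C c b = -1" "C a b = -1 \<and> C b a = -2 \<or> C a b = -2 \<and> C b a = -1"
        using cases(1,2) spherical nz False by auto
      then show ?thesis
      proof cases
        case A
        then show ?thesis using n dist far diag' by (intro stabilizer_property_3_3[OF p]) auto
      next
        case B
        then show ?thesis using n dist far diag' by (intro stabilizer_property_3_4[OF p]) auto
      next
        case D
        then show ?thesis using n dist far diag' by (intro stabilizer_property_4_3[OF p]) auto
      qed
    qed
    then show ?thesis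
      using dist by (intro meet_property_by_stabilizer) auto
  qed
  show "meet_property n p C {a, b} {b, c}"
  proof (cases "C a b * C b a \<le> 2")
    case True
    then have "C a b = 0 \<or> \<not> int p dvd C a b" using cases(1) ndvd by auto
    then have "stabilizer_property n p C a {b}"
      using n dist diag' True ab by (intro stabilizer_property_dihedral[OF p]) auto
    then show ?thesis
      using dist by (intro meet_property_by_stabilizer) auto
  next
    case False
    \<comment> \<open>A mark 6 between \<open>a\<close> and \<open>b\<close> exhausts the bound, so \<open>c\<close> commutes with \<open>b\<close>.\<close>
    then have "C b c = 0" "C c b = 0" using spherical cases(2) by auto
    then have "stabilizer_property n p C c {b}"
      using n dist diag' by (intro stabilizer_property_commuting[OF p]) auto
    then have "meet_property n p C {c, b} {a, b}"
      using dist by (intro meet_property_by_stabilizer) auto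
    then show ?thesis by (simp add: meet_property_sym insert_commute)
  qed
  show "meet_property n p C {b, c} {c, d}"
  proof (cases "C b c = 0 \<or> \<not> int p dvd C b c")
    case True
    have "C b c * C c b \<le> 3" using spherical cases(1) by auto
    then have "stabilizer_property n p C b {c}"
      using n dist diag' True bc by (intro stabilizer_property_dihedral[OF p]) auto
    then show ?thesis
      using dist by (intro meet_property_by_stabilizer) auto
  next
    case False
    \<comment> \<open>The stabiliser of \<open>e\<^sub>b\<close> is unavailable only here, so the one of \<open>e\<^sub>d\<close> is tried.\<close>
    then have "C b c = -3" "C c b = -1" using cases(1,2) spherical ndvd by auto
    with False dvd_3 have p3: "p = 3" by simp
    show ?thesis
    proof (cases "C d c = -3")
      case True
      then have "C c d = -1" using cases(3) by auto
      have "meet_property n 3 C {b, c} {c, d}"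
      proof (rule meet_property_6_6_mod_3)
        fix j assume "j < n" "j \<notin> {b, c, d}"
        then have "j = a" using nodes by blast
        then show "C c j = 0 \<and> C d j = 0" using far by simp
      qed (use True \<open>C c d = -1\<close> \<open>C b c = -3\<close> \<open>C c b = -1\<close> n dist diag' far in simp_all)
      then show ?thesis by (simp add: p3)
    next
      case False
      have "stabilizer_property n p C d {c}"
      proof (cases "C c d * C d c = 4")
        case True
        then have "[C d c * C c d = 1] (mod int p)" by (simp add: p3 cong_def mult.commute)
        then show ?thesis
          using n dist diag' by (intro stabilizer_property_dihedral[OF p]) auto
      next
        case ne: False
        have "C d c * C c d \<le> 3" "C d c = 0 \<or> \<not> int p dvd C d c"
          using cases(3) ne False ndvd by (auto simp: mult.commute)
        moreover have "crystallographic_pair (C d c) (C c d)"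
          using cd by (auto simp: crystallographic_pair_def mult.commute)
        ultimately show ?thesis
          using n dist diag' by (intro stabilizer_property_dihedral[OF p]) auto
      qed
      then have "meet_property n p C {d, c} {b, c}"
        using dist by (intro meet_property_by_stabilizer) auto
      then show ?thesis by (simp add: meet_property_sym insert_commute)
    qed
  qed
qed

section \<open>All intersections in rank 4\<close>

text \<open>
  Transitivity of intersections: \<open>\<langle>I\<rangle> \<inter> \<langle>J\<rangle> \<subseteq> \<langle>H\<rangle> \<inter> \<langle>J\<rangle> = \<langle>H \<inter> J\<rangle>\<close>.
\<close>

lemma meet_property_restrict:
  assumes "meet_property n p C H J" "I \<subseteq> H" "meet_property n p C I (H \<inter> J)"
  shows "meet_property n p C I J"
  unfolding meet_property_def
proof (intro allI impI)
  fix u w assume u: "set u \<subseteq> I" and "set w \<subseteq> J" "same_action n p C u w"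
  then obtain z where z: "set z \<subseteq> H \<inter> J" "same_action n p C u z"
    using assms(1,2) unfolding meet_property_def by (meson order_trans)
  with assms(3) u obtain z' where "set z' \<subseteq> I \<inter> (H \<inter> J)" "same_action n p C u z'"
    unfolding meet_property_def by meson
  then show "\<exists>z. set z \<subseteq> I \<inter> J \<and> same_action n p C u z" by blast
qed

text \<open>
  Removing commuting nodes turns every subset of the four nodes into one of seven connected sets (the
  \<open>cores\<close>, the empty set included).  Among these the pairs that are neither nested nor disjoint are the three
  in the hypotheses and two that follow from them by \<open>meet_property_restrict\<close>.
\<close>

lemma meet_property_rank_4:
  assumes p: "p \<ge> 3" and diag: "\<And>i. i < 4 \<Longrightarrow> C i i = 2"
    and far: "\<And>i j. i < 4 \<Longrightarrow> j < 4 \<Longrightarrow> i + 2 \<le> j \<Longrightarrow> C i j = 0 \<and> C j i = 0"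
    and meet: "meet_property 4 p C {0, 1, 2} {1, 2, 3}" "meet_property 4 p C {0, 1} {1, 2}"
      "meet_property 4 p C {1, 2} {2, 3}"
    and I: "I \<subseteq> {..<4}" and J: "J \<subseteq> {..<4}"
  shows "meet_property 4 p C I J"
proof -
  define cores where "cores = {{}, {0, 1}, {1, 2}, {2, 3}, {0, 1, 2}, {1, 2, 3}, {0, 1, 2, 3::nat}}"
  have all: "{0, 1, 2, 3} = {..<4::nat}" by auto
  \<comment> \<open>Enough for one argument; by symmetry it is then applied to both.\<close>
  have from_cores: "meet_property 4 p C H L"
    if core: "\<And>K. K \<in> cores \<Longrightarrow> meet_property 4 p C K L" 
      and H: "H \<subseteq> {..<4}" and L: "L \<subseteq> {..<4}" for H L
  proof -
    have isolated: "meet_property 4 p C (insert i K) L"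
      if "meet_property 4 p C K L" "insert i K \<subseteq> {..<4}" "\<forall>j\<in>K. i + 2 \<le> j \<or> j + 2 \<le> i" for i K
    proof (rule meet_property_insert_commuting[OF p that(2) L])
      fix j assume "j \<in> K"
      with that(2,3) have "i < 4" "j < 4" "i + 2 \<le> j \<or> j + 2 \<le> i" by auto
      then show "C i j = 0 \<and> C j i = 0" using far[of i j] far[of j i] by blast
    qed (use that diag in auto)
    have empty: "meet_property 4 p C {} L" and "meet_property 4 p C {0, 1} L"
      and "meet_property 4 p C {2, 3} L"
      using core by (auto simp: cores_def)
    then have "meet_property 4 p C {i} L" if "i < 4" for i
      using that by (intro isolated) auto
    note singleton = this
    have "meet_property 4 p C {0, 1, 3} L"
      using isolated[of "{0, 1}" 3] \<open>meet_property 4 p C {0, 1} L\<close> by (simp add: insert_commute)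
    with singleton have reducible: "meet_property 4 p C {0} L" "meet_property 4 p C {1} L"
      "meet_property 4 p C {2} L" "meet_property 4 p C {3} L"
      "meet_property 4 p C {0, 2} L" "meet_property 4 p C {0, 3} L" "meet_property 4 p C {1, 3} L"
      "meet_property 4 p C {0, 1, 3} L" "meet_property 4 p C {0, 2, 3} L"
      using isolated[of "{2}" 0] isolated[of "{3}" 0] isolated[of "{3}" 1] isolated[of "{2, 3}" 0]
        \<open>meet_property 4 p C {2, 3} L\<close>
      by simp_all
    define P where "P i = (if i \<in> H then {i} else {})" for i
    have "H = P 0 \<union> P 1 \<union> P 2 \<union> P 3"
    proof -
      have "H = (\<Union>i\<in>{0, 1, 2, 3}. P i)" using H unfolding all P_def by auto
      then show ?thesis by auto
    qed
    then have "H \<in> cores \<or> H \<in> {{0}, {1}, {2}, {3}, {0, 2}, {0, 3}, {1, 3}, {0, 1, 3}, {0, 2, 3}}"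
      unfolding P_def cores_def
      by (cases "0 \<in> H"; cases "1 \<in> H"; cases "2 \<in> H"; cases "3 \<in> H"; simp add: insert_commute)
    then show ?thesis
    proof
      assume "H \<in> cores"
      then show ?thesis by (rule core)
    next
      assume "H \<in> {{0}, {1}, {2}, {3}, {0, 2}, {0, 3}, {1, 3}, {0, 1, 3}, {0, 2, 3}}"
      then show ?thesis by (elim insertE emptyE) (simp_all only: reducible)
    qed
  qed
  have outer: "meet_property 4 p C {0, 1} {1, 2, 3}"
    using meet(2) by (intro meet_property_restrict[OF meet(1)]) simp_all
  have outer': "meet_property 4 p C {2, 3} {0, 1, 2}"
    using meet_property_sym[OF meet(3)]
    by (intro meet_property_restrict[OF meet_property_sym[OF meet(1)]]) simp_all
  have "meet_property 4 p C {0, 1} {2, 3}" by (rule meet_property_disjoint) auto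
  note cross = this meet outer outer'
  have cores: "meet_property 4 p C K L" if "K \<in> cores" "L \<in> cores" for K L
  proof (cases "K \<subseteq> L \<or> L \<subseteq> K")
    case True
    then show ?thesis using meet_property_subset meet_property_sym by blast
  next
    case False
    with that show ?thesis unfolding cores_def
      by (elim insertE emptyE) (simp_all add: cross cross[THEN meet_property_sym] del: One_nat_def)
  qed
  have "meet_property 4 p C K J" if "K \<in> cores" for K
  proof (rule meet_property_sym, rule from_cores)
    show "K \<subseteq> {..<4}" using that unfolding cores_def all[symmetric] by auto
  qed (use cores that J in auto)
  then show ?thesis using from_cores I J by blast
qed

section \<open>Matrix groups modulo p as groups of words\<close>

lemma index_reduce_mult:
  assumes "A \<in> carrier_mat n n" "A' \<in> carrier_mat n n" "i < n" "j < n"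
  shows "reduce_mat p (A * A') $$ (i, j) = (\<Sum>k<n. A $$ (i, k) * A' $$ (k, j)) mod int p"
  using assms by (auto simp: reduce_mat_def scalar_prod_def atLeast0LessThan)

lemma reduce_mat_in_carrier:
  assumes "A \<in> carrier_mat n n" "p > 0"
  shows "reduce_mat p A \<in> carrier (matrix_monoid_mod n p)"
  using assms by (auto simp: matrix_monoid_mod_def reduce_mat_def)

lemma reduce_mat_id:
  assumes "A \<in> carrier (matrix_monoid_mod n p)"
  shows "reduce_mat p A = A"
proof (rule eq_matI)
  fix i j assume "i < dim_row A" "j < dim_col A"
  moreover from this have "A $$ (i, j) \<in> elements_mat A" by auto
  ultimately show "reduce_mat p A $$ (i, j) = A $$ (i, j)"
    using assms by (auto simp: matrix_monoid_mod_def reduce_mat_def)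
qed (auto simp: reduce_mat_def)

text \<open>
  Reduction is multiplicative, hence the reduced product is associative.
\<close>

lemma reduce_mult_reduce:
  assumes "A \<in> carrier_mat n n" "A' \<in> carrier_mat n n"
  shows "reduce_mat p (reduce_mat p A * A') = reduce_mat p (A * A')"
    and "reduce_mat p (A * reduce_mat p A') = reduce_mat p (A * A')"
proof -
  have R: "reduce_mat p M \<in> carrier_mat n n" if "M \<in> carrier_mat n n" for M
    using that by (simp add: reduce_mat_def)
  have E: "reduce_mat p M $$ (i, j) = M $$ (i, j) mod int p" 
    if "M \<in> carrier_mat n n" "i < n" "j < n" for M i j
    using that by (simp add: reduce_mat_def)
  show "reduce_mat p (reduce_mat p A * A') = reduce_mat p (A * A')"
  proof (rule eq_matI)
    fix i j assume "i < dim_row (reduce_mat p (A * A'))" "j < dim_col (reduce_mat p (A * A'))"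
    with assms have ij: "i < n" "j < n" by (auto simp: reduce_mat_def)
    show "reduce_mat p (reduce_mat p A * A') $$ (i, j) = reduce_mat p (A * A') $$ (i, j)"
      unfolding index_reduce_mult[OF R[OF assms(1)] assms(2) ij] index_reduce_mult[OF assms ij]
      by (subst (1 2) mod_sum_eq[symmetric]) (simp add: E[OF assms(1)] ij mod_mult_left_eq)
  qed (use assms in \<open>auto simp: reduce_mat_def\<close>)
  show "reduce_mat p (A * reduce_mat p A') = reduce_mat p (A * A')"
  proof (rule eq_matI)
    fix i j assume "i < dim_row (reduce_mat p (A * A'))" "j < dim_col (reduce_mat p (A * A'))"
    with assms have ij: "i < n" "j < n" by (auto simp: reduce_mat_def)
    show "reduce_mat p (A * reduce_mat p A') $$ (i, j) = reduce_mat p (A * A') $$ (i, j)"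
      unfolding index_reduce_mult[OF assms(1) R[OF assms(2)] ij] index_reduce_mult[OF assms ij]
      by (subst (1 2) mod_sum_eq[symmetric]) (simp add: E[OF assms(2)] ij mod_mult_right_eq)
  qed (use assms in \<open>auto simp: reduce_mat_def\<close>)
qed

lemma monoid_matrix_monoid_mod:
  assumes "p > 0"
  shows "monoid (matrix_monoid_mod n p)"
proof -
  let ?M = "matrix_monoid_mod n p"
  have mult: "A \<otimes>\<^bsub>?M\<^esub> A' = reduce_mat p (A * A')" for A A'
    by (simp add: matrix_monoid_mod_def)
  have one: "\<one>\<^bsub>?M\<^esub> = reduce_mat p (1\<^sub>m n)"
    by (simp add: matrix_monoid_mod_def)
  have mat: "A \<in> carrier_mat n n" if "A \<in> carrier ?M" for A
    using that by (simp add: matrix_monoid_mod_def)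
  show ?thesis
  proof (rule monoidI)
    fix A A' A'' assume "A \<in> carrier ?M" "A' \<in> carrier ?M" "A'' \<in> carrier ?M"
    note this[THEN mat]
    then show "A \<otimes>\<^bsub>?M\<^esub> A' \<otimes>\<^bsub>?M\<^esub> A'' = A \<otimes>\<^bsub>?M\<^esub> (A' \<otimes>\<^bsub>?M\<^esub> A'')"
      by (simp add: mult reduce_mult_reduce[of _ n])
  next
    fix A assume A: "A \<in> carrier ?M"
    with mat[OF A] show "\<one>\<^bsub>?M\<^esub> \<otimes>\<^bsub>?M\<^esub> A = A" "A \<otimes>\<^bsub>?M\<^esub> \<one>\<^bsub>?M\<^esub> = A"
      by (simp_all add: mult one reduce_mult_reduce[of _ n] reduce_mat_id)
  qed (use assms mat in \<open>auto simp: mult one intro!: reduce_mat_in_carrier mult_carrier_mat[of _ n n _ n]\<close>)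
qed

definition word_mat :: "nat \<Rightarrow> nat \<Rightarrow> (nat \<Rightarrow> nat \<Rightarrow> int) \<Rightarrow> nat list \<Rightarrow> int mat" where
  "word_mat n p C w = mat n n (\<lambda>(x, j). word_row C w (unit_row x) j mod int p)"

lemma word_mat_in_carrier:
  assumes "p > 0"
  shows "word_mat n p C w \<in> carrier (matrix_monoid_mod n p)"
proof -
  have "word_mat n p C w = reduce_mat p (mat n n (\<lambda>(x, j). word_row C w (unit_row x) j))"
    by (intro eq_matI) (auto simp: word_mat_def reduce_mat_def)
  then show ?thesis using assms by (simp add: reduce_mat_in_carrier)
qed

lemma word_mat_Nil: "word_mat n p C [] = \<one>\<^bsub>matrix_monoid_mod n p\<^esub>"
  by (intro eq_matI) (auto simp: word_mat_def matrix_monoid_mod_def reduce_mat_def unit_row_def)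

text \<open>
  Matrices act on rows from the right, so concatenation of words corresponds to the product in the same
  order.
\<close>

lemma word_mat_append:
  assumes "set w \<subseteq> {..<n}"
  shows "word_mat n p C u \<otimes>\<^bsub>matrix_monoid_mod n p\<^esub> word_mat n p C w = word_mat n p C (u @ w)"
proof -
  have carrier: "word_mat n p C v \<in> carrier_mat n n" for v by (simp add: word_mat_def)
  have "reduce_mat p (word_mat n p C u * word_mat n p C w) = word_mat n p C (u @ w)"
  proof (rule eq_matI)
    fix x j assume "x < dim_row (word_mat n p C (u @ w))" "j < dim_col (word_mat n p C (u @ w))"
    then have xj: "x < n" "j < n" by (simp_all add: word_mat_def)
    let ?v = "word_row C u (unit_row x)"
    have "reduce_mat p (word_mat n p C u * word_mat n p C w) $$ (x, j) =
        (\<Sum>k<n. (?v k mod int p) * (word_row C w (unit_row k) j mod int p)) mod int p"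
      unfolding index_reduce_mult[OF carrier carrier xj] using xj by (simp add: word_mat_def)
    also have "\<dots> = (\<Sum>k<n. ?v k * word_row C w (unit_row k) j) mod int p"
      by (subst (1 2) mod_sum_eq[symmetric]) (simp add: mod_mult_eq)
    also have "\<dots> = word_row C (u @ w) (unit_row x) j mod int p"
      using word_row_expand[OF assms xj(2), of C ?v] by simp
    finally show "reduce_mat p (word_mat n p C u * word_mat n p C w) $$ (x, j) =
        word_mat n p C (u @ w) $$ (x, j)"
      using xj by (simp add: word_mat_def)
  qed (simp_all add: word_mat_def reduce_mat_def)
  then show ?thesis by (simp add: matrix_monoid_mod_def)
qed

lemma word_mat_eq_iff:
  assumes "set u \<subseteq> {..<n}" "set w \<subseteq> {..<n}"
  shows "word_mat n p C u = word_mat n p C w \<longleftrightarrow> same_action n p C u w"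
proof
  assume eq: "word_mat n p C u = word_mat n p C w"
  show "same_action n p C u w"
  proof (rule same_action_if_unit_rows[OF assms])
    fix x assume "x < n"
    show "rows_cong n p (word_row C u (unit_row x)) (word_row C w (unit_row x))"
      unfolding rows_cong_def
    proof (intro allI impI)
      fix j assume "j < n"
      from eq have "word_mat n p C u $$ (x, j) = word_mat n p C w $$ (x, j)" by simp
      with \<open>x < n\<close> \<open>j < n\<close> show "[word_row C u (unit_row x) j = word_row C w (unit_row x) j] (mod int p)"
        by (simp add: word_mat_def cong_def)
    qed
  qed
next
  assume "same_action n p C u w"
  then show "word_mat n p C u = word_mat n p C w"
    by (intro eq_matI) (auto simp: word_mat_def same_action_def rows_cong_def cong_def)
qed

lemma word_mat_letter_involution:
  assumes "i < n" "C i i = 2"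
  shows "word_mat n p C [i] \<otimes>\<^bsub>matrix_monoid_mod n p\<^esub> word_mat n p C [i] = \<one>\<^bsub>matrix_monoid_mod n p\<^esub>"
proof -
  have "same_action n p C [i, i] []"
    using assms by (intro same_actionI) (simp add: reflect_row_involution)
  with assms show ?thesis
    by (simp add: word_mat_append word_mat_eq_iff flip: word_mat_Nil[of n p C])
qed

text \<open>
  Inverses of generators are again generators, since these are involutions.
\<close>

lemma generate_eq_word_mats:
  assumes p: "p > 0" and I: "I \<subseteq> {..<n}" and diag: "\<And>i. i < n \<Longrightarrow> C i i = 2"
    and r: "\<And>i. i < n \<Longrightarrow> r i = word_mat n p C [i]"
  shows "generate (GL_mod n p) (r ` I) = word_mat n p C ` {w. set w \<subseteq> I}"
proof -
  let ?M = "matrix_monoid_mod n p"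
  have monoid: "monoid ?M" using monoid_matrix_monoid_mod[OF p] .
  have group: "group (GL_mod n p)"
    unfolding GL_mod_def by (rule monoid.units_group[OF monoid])
  have mult: "A \<otimes>\<^bsub>GL_mod n p\<^esub> A' = A \<otimes>\<^bsub>?M\<^esub> A'" and one_eq: "\<one>\<^bsub>GL_mod n p\<^esub> = \<one>\<^bsub>?M\<^esub>" for A A'
    by (simp_all add: GL_mod_def units_of_mult units_of_one)
  have inv_r: "inv\<^bsub>GL_mod n p\<^esub> (r i) = r i" if "i < n" for i
  proof (rule group.inv_equality[OF group])
    show "r i \<otimes>\<^bsub>GL_mod n p\<^esub> r i = \<one>\<^bsub>GL_mod n p\<^esub>"
      using that diag r by (simp add: mult one_eq word_mat_letter_involution)
    have "word_mat n p C [i] \<in> Units ?M"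
      unfolding Units_def using word_mat_letter_involution[of i n C p] that diag p
      by (auto intro!: word_mat_in_carrier bexI[of _ "word_mat n p C [i]"])
    then show "r i \<in> carrier (GL_mod n p)" "r i \<in> carrier (GL_mod n p)"
      using that r by (simp_all add: GL_mod_def units_of_carrier)
  qed
  show ?thesis
  proof (intro equalityI subsetI)
    fix g assume "g \<in> generate (GL_mod n p) (r ` I)"
    then show "g \<in> word_mat n p C ` {w. set w \<subseteq> I}"
    proof induction
      case one
      show ?case by (intro image_eqI[of _ _ "[]"]) (simp_all add: word_mat_Nil one_eq)
    next
      case (incl h)
      then obtain i where "i \<in> I" "h = r i" by blast
      then show ?case using I r by (intro image_eqI[of _ _ "[i]"]) auto
    next
      case (inv h)
      then obtain i where i: "i \<in> I" "h = r i" by blast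
      then have "i < n" using I by auto
      show ?case
        using i inv_r[OF \<open>i < n\<close>] r[OF \<open>i < n\<close>]
        by (intro image_eqI[of _ _ "[i]"]) auto
    next
      case (eng h h')
      then obtain u w where "set u \<subseteq> I" "h = word_mat n p C u" "set w \<subseteq> I" "h' = word_mat n p C w"
        by blast
      then show ?case using I
        by (intro image_eqI[of _ _ "u @ w"]) (auto simp: mult word_mat_append)
    qed
  next
    fix g assume "g \<in> word_mat n p C ` {w. set w \<subseteq> I}"
    then obtain w where "set w \<subseteq> I" "g = word_mat n p C w" by blast
    then show "g \<in> generate (GL_mod n p) (r ` I)"
    proof (induction w arbitrary: g rule: rev_induct)
      case Nil
      then show ?case using generate.one[of "GL_mod n p"] by (simp add: word_mat_Nil one_eq)
    next
      case (snoc i w)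
      then have i: "i \<in> I" "i < n" using I by auto
      have "word_mat n p C w \<otimes>\<^bsub>GL_mod n p\<^esub> r i \<in> generate (GL_mod n p) (r ` I)"
        using snoc i by (intro generate.eng[OF _ generate.incl]) auto
      then show ?case using snoc.prems i r by (simp add: mult word_mat_append)
    qed
  qed
qed

lemma C_group_if_meet_property:
  assumes p: "p > 0" and diag: "\<And>i. i < n \<Longrightarrow> C i i = 2"
    and r: "\<And>i. i < n \<Longrightarrow> r i = word_mat n p C [i]"
    and meet: "\<And>I J. I \<subseteq> {..<n} \<Longrightarrow> J \<subseteq> {..<n} \<Longrightarrow> meet_property n p C I J"
  shows "C_group (GL_mod n p) n r"
  unfolding C_group_def
proof (intro allI impI)
  fix I J assume I: "I \<subseteq> {..<n}" and J: "J \<subseteq> {..<n}"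
  then have "I \<inter> J \<subseteq> {..<n}" by blast
  note gen = generate_eq_word_mats[of p _ n C r, OF p _ diag r]
  have "word_mat n p C ` {w. set w \<subseteq> I} \<inter> word_mat n p C ` {w. set w \<subseteq> J} =
      word_mat n p C ` {w. set w \<subseteq> I \<inter> J}"
  proof (intro equalityI subsetI)
    fix g assume "g \<in> word_mat n p C ` {w. set w \<subseteq> I} \<inter> word_mat n p C ` {w. set w \<subseteq> J}"
    then obtain u w where uw: "set u \<subseteq> I" "set w \<subseteq> J" "g = word_mat n p C u" "g = word_mat n p C w"
      by blast
    then have "same_action n p C u w"
      using I J by (subst word_mat_eq_iff[symmetric]) auto
    with meet[OF I J] uw obtain z where z: "set z \<subseteq> I \<inter> J" "same_action n p C u z"
      unfolding meet_property_def by blast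
    then have "g = word_mat n p C z"
      using uw I by (simp add: word_mat_eq_iff subset_iff)
    with z show "g \<in> word_mat n p C ` {w. set w \<subseteq> I \<inter> J}" by blast
  qed auto
  then show "generate (GL_mod n p) (r ` I) \<inter> generate (GL_mod n p) (r ` J) =
      generate (GL_mod n p) (r ` (I \<inter> J))"
    using gen[OF I] gen[OF J] gen[OF \<open>I \<inter> J \<subseteq> {..<n}\<close>] by simp
qed

section \<open>Cartan integers of a basic system\<close>

text \<open>
  For a basic system the quotient is an integer, and the floor only changes its type; see
  \<open>of_int_cartan\<close>.
\<close>

definition cartan :: "('v::real_vector \<Rightarrow> 'v \<Rightarrow> real) \<Rightarrow> (nat \<Rightarrow> 'v) \<Rightarrow> nat \<Rightarrow> nat \<Rightarrow> int" where
  "cartan B b i j = \<lfloor>2 * B (b i) (b j) / B (b i) (b i)\<rfloor>"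

lemma basic_systemD:
  assumes "basic_system ps B b" "n = length ps + 1"
  shows "linear (B x)" "B x y = B y x" "inj_on b {..<n}" "independent (b ` {..<n})"
    "span (b ` {..<n}) = UNIV" "i < n \<Longrightarrow> B (b i) (b i) > 0"
    "i + 1 < n \<Longrightarrow>
       B (b i) (b (i + 1)) = - cos_mark (ps ! i) * sqrt (B (b i) (b i) * B (b (i + 1)) (b (i + 1)))"
    "i < n \<Longrightarrow> j < n \<Longrightarrow> i + 2 \<le> j \<Longrightarrow> B (b i) (b j) = 0"
    "i < n \<Longrightarrow> j < n \<Longrightarrow> 2 * B (b i) (b j) / B (b i) (b i) \<in> \<int>"
  using assms unfolding basic_system_def Let_def by auto

lemma of_int_cartan:
  assumes "basic_system ps B b" "n = length ps + 1" "i < n" "j < n"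
  shows "real_of_int (cartan B b i j) = 2 * B (b i) (b j) / B (b i) (b i)"
  using basic_systemD(9)[OF assms] by (auto simp: cartan_def elim: Ints_cases)

lemma cartan_diagonal:
  assumes "basic_system ps B b" "n = length ps + 1" "i < n"
  shows "cartan B b i i = 2"
  using basic_systemD(6)[OF assms] by (simp add: cartan_def)

lemma cartan_far:
  assumes "basic_system ps B b" "n = length ps + 1" "i < n" "j < n" "i + 2 \<le> j"
  shows "cartan B b i j = 0" "cartan B b j i = 0"
  using basic_systemD(8)[OF assms] basic_systemD(2)[OF assms(1,2), of "b j" "b i"]
  by (simp_all add: cartan_def)

lemma cos_mark_bounds:
  assumes "q \<ge> 2"
  shows "0 \<le> cos_mark q" "cos_mark q \<le> 1"
proof -
  have "0 \<le> cos_mark q \<and> cos_mark q \<le> 1"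
  proof (cases q)
    case (enat k)
    then have "k \<ge> 2" using assms by (simp add: numeral_eq_enat)
    then have "pi / real k \<le> pi / 2" by (intro divide_left_mono) auto
    moreover have "0 \<le> pi / real k" by simp
    then have "- (pi / 2) \<le> pi / real k" using pi_ge_zero by linarith
    ultimately have "0 \<le> cos (pi / real k)" by (intro cos_ge_zero)
    then show ?thesis using enat by (simp add: cos_mark_def)
  qed (simp add: cos_mark_def)
  then show "0 \<le> cos_mark q" "cos_mark q \<le> 1" by auto
qed

text \<open>
  The product of the two Cartan integers is four times the squared cosine of the mark.
\<close>

lemma cartan_neighbours:
  assumes bs: "basic_system ps B b" and n: "n = length ps + 1" and i: "i + 1 < n" and q: "ps ! i \<ge> 2"
  shows "crystallographic_pair (cartan B b i (i + 1)) (cartan B b (i + 1) i)"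
proof -
  define s t c where "s = B (b i) (b i)" and "t = B (b (i + 1)) (b (i + 1))" and "c = cos_mark (ps ! i)"
  have pos: "s > 0" "t > 0" and c: "0 \<le> c" "c \<le> 1"
    using basic_systemD(6)[OF bs n] i cos_mark_bounds[OF q] by (auto simp: s_def t_def c_def)
  have off: "B (b i) (b (i + 1)) = - c * sqrt (s * t)" "B (b (i + 1)) (b i) = - c * sqrt (s * t)"
    using basic_systemD(7)[OF bs n i] basic_systemD(2)[OF bs n, of "b (i + 1)" "b i"]
    by (simp_all add: s_def t_def c_def)
  have x: "real_of_int (cartan B b i (i + 1)) = - (2 * c * sqrt (s * t) / s)"
    and y: "real_of_int (cartan B b (i + 1) i) = - (2 * c * sqrt (s * t) / t)"
    using of_int_cartan[OF bs n, of i "i + 1"] of_int_cartan[OF bs n, of "i + 1" i] i off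
    by (simp_all add: s_def t_def)
  show ?thesis
  proof (cases "c = 0")
    case True
    with x y show ?thesis by (simp add: crystallographic_pair_def)
  next
    case False
    with pos c have "2 * c * sqrt (s * t) / s > 0" "2 * c * sqrt (s * t) / t > 0" by auto
    then have neg: "cartan B b i (i + 1) < 0" "cartan B b (i + 1) i < 0"
      using x y by linarith+
    have "(2 * c * r / s) * (2 * c * r / t) = 4 * c\<^sup>2 * (r\<^sup>2 / (s * t))" for r
      by (simp add: power2_eq_square)
    from this[of "sqrt (s * t)"] 
    have "real_of_int (cartan B b i (i + 1) * cartan B b (i + 1) i) = 4 * c\<^sup>2"
      using pos by (simp only: of_int_mult x y minus_mult_minus) simp
    also have "\<dots> \<le> 4" using c by (simp add: power_le_one)
    finally have "cartan B b i (i + 1) * cartan B b (i + 1) i \<le> 4" by linarith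
    with neg show ?thesis by (simp add: crystallographic_pair_def)
  qed
qed

lemma reduced_refl_eq_word_mat:
  assumes bs: "basic_system ps B b" and n: "n = length ps + 1" and i: "i < n"
  shows "reduced_refl n p B b i = word_mat n p (cartan B b) [i]"
proof (rule eq_matI)
  fix a j assume "a < dim_row (word_mat n p (cartan B b) [i])" "j < dim_col (word_mat n p (cartan B b) [i])"
  then have aj: "a < n" "j < n" by (simp_all add: word_mat_def)
  have "real_of_int (refl_mat n B b i $$ (a, j)) =
      real_of_int (word_row (cartan B b) [i] (unit_row a) j)"
    unfolding of_int_refl_mat[OF bs n i aj(2,1)] representation_reflection[OF bs n i aj(2,1)]
    using of_int_cartan[OF bs n i aj(2)] by (auto simp: reflect_row_def unit_row_def)
  then have "refl_mat n B b i $$ (a, j) = word_row (cartan B b) [i] (unit_row a) j"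
    by linarith
  then show "reduced_refl n p B b i $$ (a, j) = word_mat n p (cartan B b) [i] $$ (a, j)"
    using aj by (simp add: reduced_refl_def reduce_mat_def word_mat_def refl_mat_def)
qed (simp_all add: reduced_refl_def reduce_mat_def word_mat_def refl_mat_def)

section \<open>Finite reflection subgroups\<close>

lemma linear_reflection:
  assumes bs: "basic_system ps B b"
  shows "linear (reflection B b i)"
proof -
  have lin: "linear (B (b i))" using basic_systemD(1)[OF bs refl] .
  have eq: "reflection B b i x = x - (2 / B (b i) (b i) * B (b i) x) *\<^sub>R b i" for x
    using basic_systemD(2)[OF bs refl, of x "b i"] by (simp add: reflection_def)
  show ?thesis
    by (intro linearI)
       (simp_all only: eq linear_add[OF lin] linear_scale[OF lin], simp_all add: algebra_simps add_divide_distrib)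
qed

lemma reflection_involution:
  assumes bs: "basic_system ps B b" and i: "i < length ps + 1"
  shows "reflection B b i (b i) = - b i" "reflection B b i (reflection B b i x) = x"
proof -
  have pos: "B (b i) (b i) > 0" using basic_systemD(6)[OF bs refl] i by auto
  then show neg: "reflection B b i (b i) = - b i"
    by (simp add: reflection_def scaleR_2)
  have lin: "linear (reflection B b i)" using linear_reflection[OF bs] .
  show "reflection B b i (reflection B b i x) = x"
    by (subst (2) reflection_def)
       (simp add: linear_diff[OF lin] linear_scale[OF lin] neg, simp add: reflection_def)
qed

lemma refl_subgroup_props:
  assumes bs: "basic_system ps B b" and I: "I \<subseteq> {..<length ps + 1}"
  shows id_in_refl_subgroup: "id \<in> refl_subgroup B b I"
    and refl_subgroup_linear: "g \<in> refl_subgroup B b I \<Longrightarrow> linear g"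
    and refl_subgroup_comp: "g \<in> refl_subgroup B b I \<Longrightarrow> i \<in> I \<Longrightarrow> g \<circ> reflection B b i \<in> refl_subgroup B b I"
proof -
  let ?G = "BijGroup (UNIV :: 'v set)" and ?r = "reflection B b"
  have group: "group ?G" by (rule group_BijGroup)
  have bij: "f \<in> carrier ?G \<longleftrightarrow> bij f" for f :: "'v \<Rightarrow> 'v"
    by (simp add: BijGroup_def Bij_def)
  have mult: "f \<otimes>\<^bsub>?G\<^esub> h = f \<circ> h" if "bij f" "bij h" for f h :: "'v \<Rightarrow> 'v"
    using that by (auto simp: BijGroup_def Bij_def compose_def)
  have one_eq: "\<one>\<^bsub>?G\<^esub> = id" by (auto simp: BijGroup_def)
  have r_r: "?r i \<circ> ?r i = id" if "i \<in> I" for i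
    using that I reflection_involution(2)[OF bs, of i] by (auto simp: fun_eq_iff)
  have r_bij: "bij (?r i)" if "i \<in> I" for i
    using r_r[OF that] r_r[OF that] by (rule o_bij)
  have inv_r: "inv\<^bsub>?G\<^esub> (?r i) = ?r i" if "i \<in> I" for i
    using r_r[OF that] r_bij[OF that]
    by (intro group.inv_equality[OF group]) (auto simp: bij mult one_eq)
  have props: "bij g \<and> linear g" if "g \<in> refl_subgroup B b I" for g
    using that unfolding refl_subgroup_def
  proof induction
    case one
    show ?case unfolding one_eq by (auto simp: bij_def inj_def surj_def intro!: linearI)
  next
    case (incl h)
    then show ?case using r_bij linear_reflection[OF bs] by auto
  next
    case (inv h)
    then show ?case using r_bij linear_reflection[OF bs] inv_r by auto
  next
    case (eng h h')
    then have h: "bij h" "linear h" "bij h'" "linear h'" by auto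
    show ?case
      unfolding mult[OF h(1,3)] using bij_comp[OF h(3,1)] linear_compose[OF h(4,2)] by (rule conjI)
  qed
  show "id \<in> refl_subgroup B b I"
    using generate.one[of ?G "?r ` I"] by (simp add: refl_subgroup_def one_eq)
  show "linear g" if "g \<in> refl_subgroup B b I" using props that by blast
  show "g \<circ> ?r i \<in> refl_subgroup B b I" if g: "g \<in> refl_subgroup B b I" and i: "i \<in> I"
  proof -
    have "g \<otimes>\<^bsub>?G\<^esub> ?r i \<in> refl_subgroup B b I"
      using g i unfolding refl_subgroup_def by (intro generate.eng[OF _ generate.incl]) auto
    then show ?thesis using props[OF g] r_bij[OF i] by (simp add: mult)
  qed
qed

text \<open>
  Averaging the standard form in the coordinates \<open>coord\<close> over the finite group gives an invariant form \<open>Q\<close>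
  that is positive definite.  Invariance under \<open>r\<^sub>m\<close> makes \<open>r\<^sub>m\<close> the \<open>Q\<close>-orthogonal reflection in \<open>b\<^sub>m\<close>, so \<open>Q\<close> has
  the same Cartan integers as \<open>B\<close>.  The vector \<open>x = - c\<^sub>i\<^sub>j b\<^sub>i + 2 b\<^sub>j - c\<^sub>k\<^sub>j b\<^sub>k\<close> is \<open>Q\<close>-orthogonal to \<open>b\<^sub>i\<close> and
  \<open>b\<^sub>k\<close>, and \<open>Q x x\<close> is \<open>4 - (c\<^sub>i\<^sub>j c\<^sub>j\<^sub>i + c\<^sub>j\<^sub>k c\<^sub>k\<^sub>j)\<close> times \<open>Q b\<^sub>j b\<^sub>j\<close>.  Both values of \<open>Q\<close> are positive.
\<close>

lemma cartan_products_if_finite: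
  assumes bs: "basic_system ps B b" and n: "n = length ps + 1"
    and nodes: "{i, j, k} \<subseteq> I" "I \<subseteq> {..<n}" "i \<noteq> j" "k \<noteq> j"
    and ik: "cartan B b i k = 0" "cartan B b k i = 0"
    and fin: "finite (refl_subgroup B b I)"
  shows "cartan B b i j * cartan B b j i + cartan B b j k * cartan B b k j < 4"
proof -
  let ?G = "refl_subgroup B b I" and ?r = "reflection B b"
  define coord where "coord m x = representation (b ` {..<n}) x (b m)" for m x
  define Q where "Q x y = (\<Sum>g\<in>?G. \<Sum>m<n. coord m (g x) * coord m (g y))" for x y
  have I: "I \<subseteq> {..<length ps + 1}" using nodes n by auto
  have lt: "m < n" if "m \<in> {i, j, k}" for m using nodes that by auto
  note G = refl_subgroup_props[OF bs I]
  have ind: "independent (b ` {..<n})" and sp: "x \<in> span (b ` {..<n})" for x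
    using basic_systemD(4,5)[OF bs n] by auto
  have coord_add: "coord m (x + y) = coord m x + coord m y"
    and coord_scale: "coord m (r *\<^sub>R x) = r * coord m x" for m x y r
    by (simp_all add: coord_def representation_add[OF ind sp sp] representation_scale[OF ind sp])
  have coord_basis: "coord m (b l) = (if m = l then 1 else 0)" if "m < n" "l < n" for m l
    using representation_basis[OF ind, of "b l"] that basic_systemD(3)[OF bs n]
    by (auto simp: coord_def inj_on_def)
  have Q_sym: "Q x y = Q y x" for x y by (simp add: Q_def mult.commute)
  have Q_add: "Q (x + y) z = Q x z + Q y z" for x y z
    unfolding Q_def sum.distrib[symmetric]
    by (intro sum.cong refl) (simp add: linear_add[OF G(2)] coord_add algebra_simps)
  have Q_scale: "Q (r *\<^sub>R x) z = r * Q x z" for r x z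
    unfolding Q_def sum_distrib_left
    by (intro sum.cong refl) (simp add: linear_scale[OF G(2)] coord_scale)
  have Q_invariant: "Q (?r m x) (?r m y) = Q x y" if "m \<in> I" for m x y
    unfolding Q_def
    using that G(3) I reflection_involution(2)[OF bs, of m]
    by (intro sum.reindex_bij_witness[of _ "\<lambda>g. g \<circ> ?r m" "\<lambda>g. g \<circ> ?r m"]) (auto simp: comp_def fun_eq_iff subset_iff)
  have Q_ge: "Q x x \<ge> (coord m x)\<^sup>2" if "m < n" for m x
  proof -
    have "(coord m x)\<^sup>2 \<le> (\<Sum>m<n. coord m (id x) * coord m (id x))"
      using that member_le_sum[of m "{..<n}" "\<lambda>m. coord m x * coord m x"] by (simp add: power2_eq_square)
    also have "\<dots> \<le> Q x x"
      unfolding Q_def using fin G(1)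
      by (intro member_le_sum[of id ?G "\<lambda>g. \<Sum>m<n. coord m (g x) * coord m (g x)"]) (auto intro!: sum_nonneg)
    finally show ?thesis .
  qed
  have Q_root: "2 * Q x (b m) = 2 * B x (b m) / B (b m) (b m) * Q (b m) (b m)" if "m \<in> I" for x m
  proof -
    define c where "c = 2 * B x (b m) / B (b m) (b m)"
    have neg: "Q z (- y) = - Q z y" for z y
      using Q_scale[of "-1" y z] by (simp add: Q_sym)
    have "Q x (b m) = Q (x - c *\<^sub>R b m) (- b m)"
      using Q_invariant[OF that, of x "b m"] that I reflection_involution(1)[OF bs, of m]
      by (auto simp: reflection_def c_def)
    also have "\<dots> = - (Q x (b m) - c * Q (b m) (b m))"
      using Q_add[of x "(- c) *\<^sub>R b m" "b m"] Q_scale[of "- c" "b m" "b m"] by (simp add: neg)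
    finally show ?thesis by (simp add: c_def)
  qed
  define C where "C l m = real_of_int (cartan B b l m)" for l m
  have C: "C l m = 2 * B (b l) (b m) / B (b l) (b l)" if "l < n" "m < n" for l m
    using of_int_cartan[OF bs n that] by (simp add: C_def)
  have sym: "B x y = B y x" and lin: "linear (B x)" for x y
    using basic_systemD(1,2)[OF bs n] by auto
  \<comment> \<open>In the affine case, where the sum of the two products is 4, this vector is orthogonal to all three roots.\<close>
  define x where "x = (- C i j) *\<^sub>R b i + 2 *\<^sub>R b j + (- C k j) *\<^sub>R b k"
  have root: "2 * B x (b m) / B (b m) (b m) = - C i j * C m i + 2 * C m j - C k j * C m k"
    if "m \<in> {i, j, k}" for m
  proof -
    have Bx: "B x (b m) = - C i j * B (b m) (b i) + 2 * B (b m) (b j) + - C k j * B (b m) (b k)"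
      by (subst sym) (simp only: x_def linear_add[OF lin] linear_scale[OF lin] real_scaleR_def)
    have Cm: "C m i = 2 * B (b m) (b i) / B (b m) (b m)" "C m j = 2 * B (b m) (b j) / B (b m) (b m)"
      "C m k = 2 * B (b m) (b k) / B (b m) (b m)"
      using lt that by (simp_all add: C)
    show ?thesis unfolding Bx Cm by (simp add: add_divide_distrib diff_divide_distrib algebra_simps)
  qed
  have diag: "C m m = 2" if "m \<in> {i, j, k}" for m
    using cartan_diagonal[OF bs n lt[OF that]] by (simp add: C_def)
  have zero: "C i k = 0" "C k i = 0" using ik by (simp_all add: C_def)
  define e where "e = 4 - (C i j * C j i + C j k * C k j)"
  have "Q x (b i) = 0" "Q x (b k) = 0" "2 * Q x (b j) = e * Q (b j) (b j)"
    using Q_root[of i x] Q_root[of j x] Q_root[of k x] nodes root diag zero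
    by (simp_all add: e_def algebra_simps)
  moreover have "Q x x = - C i j * Q x (b i) + 2 * Q x (b j) - C k j * Q x (b k)"
    by (subst (1) x_def) (simp add: Q_add Q_scale Q_sym[of "b _"] del: scaleR_minus_left)
  ultimately have "Q x x = e * Q (b j) (b j)" by simp
  moreover have "coord j x = 2"
    using lt nodes by (simp add: x_def coord_add coord_scale coord_basis del: scaleR_minus_left)
  then have "Q x x > 0" using Q_ge[OF lt[of j], of x] by simp
  moreover have "Q (b j) (b j) \<ge> 0" using Q_ge[OF lt[of j], of "b j"] by (simp add: order_trans[rotated])
  ultimately have "e > 0" using zero_less_mult_pos2[of e] by (simp add: zero_less_mult_iff)
  then have "real_of_int (cartan B b i j * cartan B b j i + cartan B b j k * cartan B b k j) < 4"
    by (simp add: e_def C_def)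
  then show ?thesis by linarith
qed

section \<open>Reductions with a spherical section of rank 3\<close>

theorem theorem3p1:
  fixes k l m :: enat and p :: nat
    and B :: "'v::real_vector \<Rightarrow> 'v \<Rightarrow> real" and b :: "nat \<Rightarrow> 'v"
  assumes "{k, l, m} \<subseteq> {2, 3, 4, 6, \<infinity>}"
    and "basic_system [k, l, m] B b"
    and "finite (refl_subgroup B b {0, 1, 2}) \<or> finite (refl_subgroup B b {1, 2, 3})"
    and "prime p" and "p \<ge> 3"
  shows "C_group (GL_mod 4 p) 4 (reduced_refl 4 p B b)"
proof -
  let ?C = "cartan B b"
  note bs = assms(2) and p = assms(5)
  have n: "4 = length [k, l, m] + 1" by simp
  have marks: "[k, l, m] ! i \<ge> 2" if "i < 3" for i
  proof -
    have "[k, l, m] ! i \<in> {k, l, m}" using that by (auto simp: less_Suc_eq numeral_3_eq_3)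
    then have "[k, l, m] ! i \<in> {2, 3, 4, 6, \<infinity>}" using assms(1) by blast
    then show ?thesis by auto
  qed
  have diag: "?C i i = 2" if "i < 4" for i
    using cartan_diagonal[OF bs n that] .
  have far: "?C i j = 0 \<and> ?C j i = 0" if "i < 4" "j < 4" "i + 2 \<le> j" for i j
    using cartan_far[OF bs n that] by simp
  have pair: "crystallographic_pair (?C i (i + 1)) (?C (i + 1) i)" if "i < 3" for i
    using that by (intro cartan_neighbours[OF bs n]) (auto intro: marks)
  have pairs: "crystallographic_pair (?C 0 1) (?C 1 0)" "crystallographic_pair (?C 1 2) (?C 2 1)"
    "crystallographic_pair (?C 2 3) (?C 3 2)"
    using pair[of 0] pair[of 1] pair[of 2] by (simp_all add: numeral_2_eq_2 numeral_3_eq_3)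
  have zeros: "?C 0 2 = 0" "?C 2 0 = 0" "?C 0 3 = 0" "?C 3 0 = 0" "?C 1 3 = 0" "?C 3 1 = 0"
    using far[of 0 2] far[of 0 3] far[of 1 3] by simp_all
  have nodes: "{0, 1, 2, 3} = {..<4::nat}" "{3, 2, 1, 0} = {..<4::nat}" by auto
  have "meet_property 4 p ?C {0, 1, 2} {1, 2, 3} \<and> meet_property 4 p ?C {0, 1} {1, 2} \<and>
      meet_property 4 p ?C {1, 2} {2, 3}"
    using assms(3)
  proof
    assume "finite (refl_subgroup B b {0, 1, 2})"
    then have "?C 0 1 * ?C 1 0 + ?C 1 2 * ?C 2 1 < 4"
      using zeros by (intro cartan_products_if_finite[OF bs n]) auto
    then show ?thesis
      using meet_properties_of_path[OF p, of 0 1 2 3 4 ?C] pairs zeros diag nodes by auto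
  next
    assume "finite (refl_subgroup B b {1, 2, 3})"
    then have "?C 1 2 * ?C 2 1 + ?C 2 3 * ?C 3 2 < 4"
      using zeros by (intro cartan_products_if_finite[OF bs n]) auto
    \<comment> \<open>The same path read backwards.\<close>
    then have "meet_property 4 p ?C {3, 2, 1} {2, 1, 0}" "meet_property 4 p ?C {3, 2} {2, 1}"
      "meet_property 4 p ?C {2, 1} {1, 0}"
      using meet_properties_of_path[OF p, of 3 2 1 0 4 ?C] pairs[THEN crystallographic_pair_sym] zeros diag nodes
      by (auto simp: mult.commute)
    from this[THEN meet_property_sym] show ?thesis
      by (simp add: insert_commute)
  qed
  then have core: "meet_property 4 p ?C {0, 1, 2} {1, 2, 3}" "meet_property 4 p ?C {0, 1} {1, 2}"
    "meet_property 4 p ?C {1, 2} {2, 3}" by blast+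
  show ?thesis
  proof (rule C_group_if_meet_property[where C = ?C])
    show "meet_property 4 p ?C I J" if "I \<subseteq> {..<4}" "J \<subseteq> {..<4}" for I J
      using p diag far core that by (rule meet_property_rank_4[where C = ?C])
    show "reduced_refl 4 p B b i = word_mat 4 p ?C [i]" if "i < 4" for i
      using bs n that by (rule reduced_refl_eq_word_mat)
  qed (use p diag in simp_all)
qed

end
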